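(* Let $\mathfrak{a}$ be a two-sided ideal of a Leibniz algebra $\mathfrak{q}$ over $\mathbb{K}$ such that $\mathfrak{a}\subseteq Z_{\mathrm{Lie}}(\mathfrak{q})$. Then $\mathfrak{a}\subseteq Z^{*}_{\mathrm{Lie}}(\mathfrak{q})$ if and only if the map $C:\mathfrak{a}\otimes\mathfrak{q}_{\mathrm{Lie}}\to HL^{\mathrm{Lie}}_2(\mathfrak{q})$, namely the first map of the six-term exact sequence $$\mathfrak{a}\otimes\mathfrak{q}_{\mathrm{Lie}}\stackrel{C}{\to}HL^{\mathrm{Lie}}_2(\mathfrak{q})\to HL^{\mathrm{Lie}}_2(\mathfrak{q}/\mathfrak{a})\to\mathfrak{a}\to\mathfrak{q}_{\mathrm{Lie}}\to(\mathfrak{q}/\mathfrak{a})_{\mathrm{Lie}}\to0$$ associated to the $\mathrm{Lie}$-central extension $0\to\mathfrak{a}\to\mathfrak{q}\stackrel{\pi}{\to}\mathfrak{q}/\mathfrak{a}\to0$, is the zero map.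
   Context: $\mathbb{K}$ is a field with $\frac12\in\mathbb{K}$; tensor products are over $\mathbb{K}$. A Leibniz algebra is a $\mathbb{K}$-vector space with a bilinear bracket satisfying $[x,[y,z]]=[[x,y],z]-[[x,z],y]$. $\mathfrak{q}^{\mathrm{ann}}$ is the span of all $[x,x]$ (a two-sided ideal), $\mathfrak{q}_{\mathrm{Lie}}=\mathfrak{q}/\mathfrak{q}^{\mathrm{ann}}$. For two-sided ideals $\mathfrak{m},\mathfrak{n}$ of $\mathfrak{q}$, $[\mathfrak{m},\mathfrak{n}]_{\mathrm{Lie}}$ is the span of all $[m,n]+[n,m]$, $m\in\mathfrak{m}$, $n\in\mathfrak{n}$. $Z_{\mathrm{Lie}}(\mathfrak{q})=\{z\in\mathfrak{q}\mid[x,z]+[z,x]=0\ \forall x\in\mathfrak{q}\}$. A $\mathrm{Lie}$-central extension is a surjective homomorphism $f:\mathfrak{g}\twoheadrightarrow\mathfrak{q}$ of Leibniz algebras with $\ker f\subseteq Z_{\mathrm{Lie}}(\mathfrak{g})$. The precise $\mathrm{Lie}$-center $Z^{*}_{\mathrm{Lie}}(\mathfrak{q})$ is the intersection of all $f(Z_{\mathrm{Lie}}(\mathfrak{g}))$ over all $\mathrm{Lie}$-central extensions $f:\mathfrak{g}\twoheadrightarrow\mathfrak{q}$. For a free presentation $0\to\mathfrak{r}\to\mathfrak{f}\stackrel{\rho}{\to}\mathfrak{q}\to0$ ($\mathfrak{f}$ a free Leibniz algebra), $HL^{\mathrm{Lie}}_2(\mathfrak{q})=(\mathfrak{r}\cap[\mathfrak{f},\mathfrak{f}]_{\mathrm{Lie}})/[\mathfrak{r},\mathfrak{f}]_{\mathrm{Lie}}$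 (independent of the presentation up to canonical isomorphism). With $\mathfrak{s}=\ker(\pi\circ\rho)$, the map $HL^{\mathrm{Lie}}_2(\mathfrak{q})\to HL^{\mathrm{Lie}}_2(\mathfrak{q}/\mathfrak{a})=(\mathfrak{s}\cap[\mathfrak{f},\mathfrak{f}]_{\mathrm{Lie}})/[\mathfrak{s},\mathfrak{f}]_{\mathrm{Lie}}$ is induced by $\mathfrak{r}\subseteq\mathfrak{s}$, and $C$ is given by $C(a\otimes\overline{x})=[s,y]+[y,s]+[\mathfrak{r},\mathfrak{f}]_{\mathrm{Lie}}$, where $s\in\mathfrak{s}$, $y\in\mathfrak{f}$ satisfy $\rho(s)=a$, $\rho(y)=x$.
   Formalization: The formula for C need not be well defined on 𝔞⊗𝔮_Lie, since [[u,u],s] may lie outside [𝔯,𝔣]_Lie. It is proved that the equivalence holds for any linear C satisfying the formula, and that 𝔞⊆Z*_Lie(𝔮) iff such a C exists and is zero. *)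

theory Defs
  imports "HOL-Algebra.Module" "HOL-Algebra.AbelCoset"
begin

section \<open>Linear algebra over a commutative ring\<close>

definition lin_span :: "('k, 'r) ring_scheme \<Rightarrow> ('k, 'a, 'm) module_scheme \<Rightarrow> 'a set \<Rightarrow> 'a set" where
  "lin_span K M S = \<Inter>{H. submodule H K M \<and> S \<subseteq> H}"

definition linear_hom ::
  "('k, 'r) ring_scheme \<Rightarrow> ('k, 'a, 'm) module_scheme \<Rightarrow> ('k, 'b, 'n) module_scheme \<Rightarrow> ('a \<Rightarrow> 'b) set" where
  "linear_hom K M N = {f \<in> carrier M \<rightarrow> carrier N.
     (\<forall>x\<in>carrier M. \<forall>y\<in>carrier M. f (x \<oplus>\<^bsub>M\<^esub> y) = f x \<oplus>\<^bsub>N\<^esub> f y) \<and>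
     (\<forall>c\<in>carrier K. \<forall>x\<in>carrier M. f (c \<odot>\<^bsub>M\<^esub> x) = c \<odot>\<^bsub>N\<^esub> f x)}"

text \<open>The fields \<open>mult\<close> and \<open>one\<close> of a module record play no role and are left unspecified.\<close>

definition quot_module ::
  "('k, 'a, 'm) module_scheme \<Rightarrow> 'a set \<Rightarrow> ('k, 'a set) module" where
  "quot_module M N =
    \<lparr>carrier = a_rcosets\<^bsub>M\<^esub> N, mult = undefined, one = undefined,
     zero = N, add = set_add M,
     smult = (\<lambda>c X. \<Union>x\<in>X. N +>\<^bsub>M\<^esub> (c \<odot>\<^bsub>M\<^esub> x))\<rparr>"

definition free_module :: "('k, 'r) ring_scheme \<Rightarrow> 'b set \<Rightarrow> ('k, 'b \<Rightarrow> 'k) module" where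
  "free_module K B =
    \<lparr>carrier = {\<phi>. range \<phi> \<subseteq> carrier K \<and> (\<forall>b. b \<notin> B \<longrightarrow> \<phi> b = \<zero>\<^bsub>K\<^esub>) \<and> finite {b. \<phi> b \<noteq> \<zero>\<^bsub>K\<^esub>}},
     mult = undefined, one = undefined,
     zero = (\<lambda>_. \<zero>\<^bsub>K\<^esub>), add = (\<lambda>\<phi> \<psi> b. \<phi> b \<oplus>\<^bsub>K\<^esub> \<psi> b),
     smult = (\<lambda>c \<phi> b. c \<otimes>\<^bsub>K\<^esub> \<phi> b)\<rparr>"

definition free_gen :: "('k, 'r) ring_scheme \<Rightarrow> 'b \<Rightarrow> 'b \<Rightarrow> 'k" where
  "free_gen K b = (\<lambda>b'. if b' = b then \<one>\<^bsub>K\<^esub> else \<zero>\<^bsub>K\<^esub>)"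

definition tensor_relators ::
  "('k, 'r) ring_scheme \<Rightarrow> ('k, 'a, 'm) module_scheme \<Rightarrow> ('k, 'b, 'n) module_scheme \<Rightarrow> ('a \<times> 'b \<Rightarrow> 'k) set" where
  "tensor_relators K M N =
    (let T = free_module K (carrier M \<times> carrier N); e = (\<lambda>m n. free_gen K (m, n)) in
      {e (m \<oplus>\<^bsub>M\<^esub> m') n \<ominus>\<^bsub>T\<^esub> (e m n \<oplus>\<^bsub>T\<^esub> e m' n) | m m' n.
         m \<in> carrier M \<and> m' \<in> carrier M \<and> n \<in> carrier N} \<union>
      {e m (n \<oplus>\<^bsub>N\<^esub> n') \<ominus>\<^bsub>T\<^esub> (e m n \<oplus>\<^bsub>T\<^esub> e m n') | m n n'.
         m \<in> carrier M \<and> n \<in> carrier N \<and> n' \<in> carrier N} \<union>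
      {e (c \<odot>\<^bsub>M\<^esub> m) n \<ominus>\<^bsub>T\<^esub> c \<odot>\<^bsub>T\<^esub> e m n | c m n.
         c \<in> carrier K \<and> m \<in> carrier M \<and> n \<in> carrier N} \<union>
      {e m (c \<odot>\<^bsub>N\<^esub> n) \<ominus>\<^bsub>T\<^esub> c \<odot>\<^bsub>T\<^esub> e m n | c m n.
         c \<in> carrier K \<and> m \<in> carrier M \<and> n \<in> carrier N})"

definition tensor_rel_span ::
  "('k, 'r) ring_scheme \<Rightarrow> ('k, 'a, 'm) module_scheme \<Rightarrow> ('k, 'b, 'n) module_scheme \<Rightarrow> ('a \<times> 'b \<Rightarrow> 'k) set" where
  "tensor_rel_span K M N =
    lin_span K (free_module K (carrier M \<times> carrier N)) (tensor_relators K M N)"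

definition tensor ::
  "('k, 'r) ring_scheme \<Rightarrow> ('k, 'a, 'm) module_scheme \<Rightarrow> ('k, 'b, 'n) module_scheme \<Rightarrow> ('k, ('a \<times> 'b \<Rightarrow> 'k) set) module" where
  "tensor K M N = quot_module (free_module K (carrier M \<times> carrier N)) (tensor_rel_span K M N)"

definition pure_tensor ::
  "('k, 'r) ring_scheme \<Rightarrow> ('k, 'a, 'm) module_scheme \<Rightarrow> ('k, 'b, 'n) module_scheme \<Rightarrow> 'a \<Rightarrow> 'b \<Rightarrow> ('a \<times> 'b \<Rightarrow> 'k) set" where
  "pure_tensor K M N m n =
    tensor_rel_span K M N +>\<^bsub>free_module K (carrier M \<times> carrier N)\<^esub> free_gen K (m, n)"


section \<open>Leibniz algebras\<close>

record ('k, 'a) leibniz = "('k, 'a) module" +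
  bracket :: "'a \<Rightarrow> 'a \<Rightarrow> 'a"

locale leibniz_algebra = module K Q
  for K :: "('k, 'r) ring_scheme" (structure) and Q :: "('k, 'q) leibniz" (structure) +
  assumes bracket_closed: "\<lbrakk>x \<in> carrier Q; y \<in> carrier Q\<rbrakk> \<Longrightarrow> bracket Q x y \<in> carrier Q"
    and bracket_add_left: "\<lbrakk>x \<in> carrier Q; y \<in> carrier Q; z \<in> carrier Q\<rbrakk> \<Longrightarrow>
      bracket Q (x \<oplus>\<^bsub>Q\<^esub> y) z = bracket Q x z \<oplus>\<^bsub>Q\<^esub> bracket Q y z"
    and bracket_add_right: "\<lbrakk>x \<in> carrier Q; y \<in> carrier Q; z \<in> carrier Q\<rbrakk> \<Longrightarrow>
      bracket Q x (y \<oplus>\<^bsub>Q\<^esub> z) = bracket Q x y \<oplus>\<^bsub>Q\<^esub> bracket Q x z"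
    and bracket_smult_left: "\<lbrakk>c \<in> carrier K; x \<in> carrier Q; y \<in> carrier Q\<rbrakk> \<Longrightarrow>
      bracket Q (c \<odot>\<^bsub>Q\<^esub> x) y = c \<odot>\<^bsub>Q\<^esub> bracket Q x y"
    and bracket_smult_right: "\<lbrakk>c \<in> carrier K; x \<in> carrier Q; y \<in> carrier Q\<rbrakk> \<Longrightarrow>
      bracket Q x (c \<odot>\<^bsub>Q\<^esub> y) = c \<odot>\<^bsub>Q\<^esub> bracket Q x y"
    and leibniz_identity: "\<lbrakk>x \<in> carrier Q; y \<in> carrier Q; z \<in> carrier Q\<rbrakk> \<Longrightarrow>
      bracket Q x (bracket Q y z) = bracket Q (bracket Q x y) z \<ominus>\<^bsub>Q\<^esub> bracket Q (bracket Q x z) y"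

definition leibniz_hom ::
  "('k, 'r) ring_scheme \<Rightarrow> ('k, 'a) leibniz \<Rightarrow> ('k, 'b) leibniz \<Rightarrow> ('a \<Rightarrow> 'b) set" where
  "leibniz_hom K G H = {f \<in> linear_hom K G H.
     \<forall>x\<in>carrier G. \<forall>y\<in>carrier G. f (bracket G x y) = bracket H (f x) (f y)}"

definition leibniz_ideal :: "('k, 'r) ring_scheme \<Rightarrow> ('k, 'a) leibniz \<Rightarrow> 'a set \<Rightarrow> bool" where
  "leibniz_ideal K Q I \<longleftrightarrow> submodule I K Q \<and>
     (\<forall>x\<in>I. \<forall>y\<in>carrier Q. bracket Q x y \<in> I \<and> bracket Q y x \<in> I)"

definition quot_leibniz :: "('k, 'a) leibniz \<Rightarrow> 'a set \<Rightarrow> ('k, 'a set) leibniz" where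
  "quot_leibniz Q I = module.extend (quot_module Q I)
     (leibniz.fields (\<lambda>X Y. \<Union>x\<in>X. \<Union>y\<in>Y. I +>\<^bsub>Q\<^esub> bracket Q x y))"

definition leibniz_ann :: "('k, 'r) ring_scheme \<Rightarrow> ('k, 'a) leibniz \<Rightarrow> 'a set" where
  "leibniz_ann K Q = lin_span K Q {bracket Q x x | x. x \<in> carrier Q}"

definition liezation :: "('k, 'r) ring_scheme \<Rightarrow> ('k, 'a) leibniz \<Rightarrow> ('k, 'a set) leibniz" where
  "liezation K Q = quot_leibniz Q (leibniz_ann K Q)"

definition sym_bracket :: "('k, 'a) leibniz \<Rightarrow> 'a \<Rightarrow> 'a \<Rightarrow> 'a" where
  "sym_bracket Q x y = bracket Q x y \<oplus>\<^bsub>Q\<^esub> bracket Q y x"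

definition lie_commutator ::
  "('k, 'r) ring_scheme \<Rightarrow> ('k, 'a) leibniz \<Rightarrow> 'a set \<Rightarrow> 'a set \<Rightarrow> 'a set" where
  "lie_commutator K Q M N = lin_span K Q {sym_bracket Q m n | m n. m \<in> M \<and> n \<in> N}"

definition lie_center :: "('k, 'a) leibniz \<Rightarrow> 'a set" where
  "lie_center Q = {z \<in> carrier Q. \<forall>x\<in>carrier Q. sym_bracket Q x z = \<zero>\<^bsub>Q\<^esub>}"

definition lie_central_extension ::
  "('k, 'r) ring_scheme \<Rightarrow> ('k, 'a) leibniz \<Rightarrow> ('k, 'b) leibniz \<Rightarrow> ('a \<Rightarrow> 'b) \<Rightarrow> bool" where
  "lie_central_extension K G Q f \<longleftrightarrow>
     leibniz_algebra K G \<and> leibniz_algebra K Q \<and> f \<in> leibniz_hom K G Q \<and>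
     f ` carrier G = carrier Q \<and> a_kernel G Q f \<subseteq> lie_center G"

text \<open>
  HOL cannot quantify over all types inside a definition, so the intersection ranges over the
  extensions whose underlying set is contained in the type \<^typ>\<open>'q list \<Rightarrow> 'k\<close>.  This type has room
  for a Leibniz algebra generated by \<open>'q\<close>-many elements, and nothing is lost:
  \<open>precise_lie_center_universal\<close> below shows that the resulting set is contained in
  \<open>f ` lie_center G\<close> for every Lie-central extension \<open>f\<close> on every type.
\<close>

definition precise_lie_center :: "('k, 'r) ring_scheme \<Rightarrow> ('k, 'q) leibniz \<Rightarrow> 'q set" where
  "precise_lie_center K Q =
     \<Inter>{f ` lie_center G | (G :: ('k, 'q list \<Rightarrow> 'k) leibniz) f. lie_central_extension K G Q f}"

text \<open>
  The same device is used for the universal property of free algebras;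
  \<open>free_leibniz_on_universal\<close> below extends it to targets of arbitrary type.
\<close>

definition free_leibniz_on :: "('k, 'r) ring_scheme \<Rightarrow> ('k, 'f) leibniz \<Rightarrow> 'f set \<Rightarrow> bool" where
  "free_leibniz_on K F X \<longleftrightarrow> leibniz_algebra K F \<and> X \<subseteq> carrier F \<and>
     (\<forall>(L :: ('k, 'f list \<Rightarrow> 'k) leibniz) h. leibniz_algebra K L \<and> h \<in> X \<rightarrow> carrier L \<longrightarrow>
        (\<exists>\<phi>\<in>leibniz_hom K F L. (\<forall>x\<in>X. \<phi> x = h x) \<and>
           (\<forall>\<psi>\<in>leibniz_hom K F L. (\<forall>x\<in>X. \<psi> x = h x) \<longrightarrow> (\<forall>u\<in>carrier F. \<psi> u = \<phi> u))))"

definition free_presentation ::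
  "('k, 'r) ring_scheme \<Rightarrow> ('k, 'f) leibniz \<Rightarrow> ('k, 'q) leibniz \<Rightarrow> ('f \<Rightarrow> 'q) \<Rightarrow> bool" where
  "free_presentation K F Q \<rho> \<longleftrightarrow> (\<exists>X. free_leibniz_on K F X) \<and> leibniz_algebra K Q \<and>
     \<rho> \<in> leibniz_hom K F Q \<and> \<rho> ` carrier F = carrier Q"

text \<open>\<open>HL2_Lie K F R\<close> is computed from the presentation \<open>0 \<rightarrow> R \<rightarrow> F \<rightarrow> F/R \<rightarrow> 0\<close>.\<close>

definition HL2_Lie :: "('k, 'r) ring_scheme \<Rightarrow> ('k, 'f) leibniz \<Rightarrow> 'f set \<Rightarrow> ('k, 'f set) module" where
  "HL2_Lie K F R =
     quot_module (F\<lparr>carrier := R \<inter> lie_commutator K F (carrier F) (carrier F)\<rparr>)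
       (lie_commutator K F R (carrier F))"

definition tensor_ideal_liezation ::
  "('k, 'r) ring_scheme \<Rightarrow> ('k, 'q) leibniz \<Rightarrow> 'q set \<Rightarrow> ('k, ('q \<times> 'q set \<Rightarrow> 'k) set) module" where
  "tensor_ideal_liezation K Q A = tensor K (Q\<lparr>carrier := A\<rparr>) (liezation K Q)"

text \<open>
  \<open>first_map K F Q \<rho> A C\<close> says that \<open>C\<close> is the first map of the six-term sequence attached to
  \<open>0 \<rightarrow> A \<rightarrow> Q \<rightarrow> Q/A \<rightarrow> 0\<close>: a linear map out of \<open>A \<otimes> Q\<^sub>L\<^sub>i\<^sub>e\<close> whose value at \<open>a \<otimes> x\<close> is given by the
  formula for every choice of the lifts \<open>s\<close>, \<open>y\<close>.  Since pure tensors span, at most one such map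
  exists on the carrier.  This is a predicate and not a function because the formula need not
  descend from \<open>Q\<close> to \<open>Q\<^sub>L\<^sub>i\<^sub>e\<close>: if \<open>F\<close> is free on \<open>\<sigma>\<close>, \<open>u\<close>, \<open>S\<close> is the ideal generated by \<open>\<sigma>\<close> and \<open>R\<close>
  the ideal generated by \<open>lie_commutator K F S (carrier F)\<close>, then \<open>[u,u]\<close> is zero in \<open>Q\<^sub>L\<^sub>i\<^sub>e\<close>, while
  \<open>[\<sigma>,[u,u]] + [[u,u],\<sigma>] = [[u,u],\<sigma>]\<close> is not in \<open>lie_commutator K F R (carrier F)\<close>.
\<close>

definition first_map ::
  "('k, 'r) ring_scheme \<Rightarrow> ('k, 'f) leibniz \<Rightarrow> ('k, 'q) leibniz \<Rightarrow> ('f \<Rightarrow> 'q) \<Rightarrow> 'q set \<Rightarrow>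
   (('q \<times> 'q set \<Rightarrow> 'k) set \<Rightarrow> 'f set) \<Rightarrow> bool" where
  "first_map K F Q \<rho> A C \<longleftrightarrow>
    (let R = a_kernel F Q \<rho>;
         S = a_kernel F (quot_leibniz Q A) ((\<lambda>q. A +>\<^bsub>Q\<^esub> q) \<circ> \<rho>)
     in C \<in> linear_hom K (tensor_ideal_liezation K Q A) (HL2_Lie K F R) \<and>
        (\<forall>a\<in>A. \<forall>x\<in>carrier Q. \<forall>s\<in>S. \<forall>y\<in>carrier F. \<rho> s = a \<and> \<rho> y = x \<longrightarrow>
           C (pure_tensor K (Q\<lparr>carrier := A\<rparr>) (liezation K Q) a (leibniz_ann K Q +>\<^bsub>Q\<^esub> x)) =
           lie_commutator K F R (carrier F) +>\<^bsub>F\<^esub> sym_bracket F s y))"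

definition is_zero_map :: "('k, 'a, 'm) module_scheme \<Rightarrow> ('k, 'b, 'n) module_scheme \<Rightarrow> ('a \<Rightarrow> 'b) \<Rightarrow> bool" where
  "is_zero_map M N f \<longleftrightarrow> (\<forall>x\<in>carrier M. f x = \<zero>\<^bsub>N\<^esub>)"

section \<open>Independence of the types chosen in the definitions\<close>

text \<open>
  The subalgebra generated by the image of a map \<open>h\<close> on \<open>X\<close> is spanned by the left-normed words in
  that image, hence it injects into the functions from words to scalars.
\<close>


lemma (in module) lin_span_submodule:
  assumes "S \<subseteq> carrier M" shows "submodule (lin_span R M S) R M"
proof (rule submoduleI)
  have c: "carrier M \<in> {H. submodule H R M \<and> S \<subseteq> H}"
    using carrier_is_submodule assms by auto
  show "lin_span R M S \<subseteq> carrier M" using c unfolding lin_span_def by blast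
  have sub: "\<And>H. submodule H R M \<Longrightarrow> \<zero>\<^bsub>M\<^esub> \<in> H"
    using submodule.axioms(1) subgroup.one_closed by fastforce
  show "\<zero>\<^bsub>M\<^esub> \<in> lin_span R M S" unfolding lin_span_def using sub by auto
qed (auto simp: lin_span_def dest: submoduleE)

lemma lin_span_base: "S \<subseteq> lin_span K M S" unfolding lin_span_def by auto

lemma lin_span_least: "submodule H K M \<Longrightarrow> S \<subseteq> H \<Longrightarrow> lin_span K M S \<subseteq> H"
  unfolding lin_span_def by auto

definition coeffs :: "('k, 'r) ring_scheme \<Rightarrow> 'i set \<Rightarrow> ('i \<Rightarrow> 'k) set" where
  "coeffs K I = {\<phi>. (\<forall>i. \<phi> i \<in> carrier K) \<and> (\<forall>i. \<phi> i \<noteq> \<zero>\<^bsub>K\<^esub> \<longrightarrow> i \<in> I) \<and> finite {i. \<phi> i \<noteq> \<zero>\<^bsub>K\<^esub>}}"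

definition lin_comb ::
  "('k, 'r) ring_scheme \<Rightarrow> ('k, 'a, 'm) module_scheme \<Rightarrow> ('i \<Rightarrow> 'a) \<Rightarrow> ('i \<Rightarrow> 'k) \<Rightarrow> 'a" where
  "lin_comb K M t \<phi> = finsum M (\<lambda>i. \<phi> i \<odot>\<^bsub>M\<^esub> t i) {i. \<phi> i \<noteq> \<zero>\<^bsub>K\<^esub>}"

context module begin

context
  fixes t :: "'i \<Rightarrow> 'c" and I :: "'i set"
  assumes t: "t \<in> I \<rightarrow> carrier M"
begin

lemma coeffsD:
  assumes "\<phi> \<in> coeffs R I"
  shows "\<phi> i \<in> carrier R" "{i. \<phi> i \<noteq> \<zero>} \<subseteq> I" "finite {i. \<phi> i \<noteq> \<zero>}"
  using assms unfolding coeffs_def by auto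

lemma coeffsI:
  assumes "\<And>i. \<phi> i \<in> carrier R" "{i. \<phi> i \<noteq> \<zero>} \<subseteq> S" "finite S" "S \<subseteq> I"
  shows "\<phi> \<in> coeffs R I"
  using assms(1,2,4) finite_subset[OF assms(2,3)] unfolding coeffs_def by auto

lemma term_closed: "\<phi> \<in> coeffs R I \<Longrightarrow> i \<in> I \<Longrightarrow> \<phi> i \<odot>\<^bsub>M\<^esub> t i \<in> carrier M"
  using t coeffsD(1) by (intro smult_closed) auto

lemma terms_closed: "\<phi> \<in> coeffs R I \<Longrightarrow> S \<subseteq> I \<Longrightarrow> (\<lambda>i. \<phi> i \<odot>\<^bsub>M\<^esub> t i) \<in> S \<rightarrow> carrier M"
  using term_closed by (intro funcsetI) blast

lemma lin_comb_closed: "\<phi> \<in> coeffs R I \<Longrightarrow> lin_comb R M t \<phi> \<in> carrier M"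
  unfolding lin_comb_def using coeffsD terms_closed by (intro M.finsum_closed) auto

lemma lin_comb_eq:
  assumes "\<phi> \<in> coeffs R I" "finite S" "S \<subseteq> I" "{i. \<phi> i \<noteq> \<zero>} \<subseteq> S"
  shows "lin_comb R M t \<phi> = finsum M (\<lambda>i. \<phi> i \<odot>\<^bsub>M\<^esub> t i) S"
  unfolding lin_comb_def
proof (rule M.add.finprod_mono_neutral_cong_left)
  show "\<phi> i \<odot>\<^bsub>M\<^esub> t i = \<zero>\<^bsub>M\<^esub>" if "i \<in> S - {i. \<phi> i \<noteq> \<zero>}" for i
  proof -
    have "\<phi> i = \<zero>" "t i \<in> carrier M" using that assms(3) t by auto
    then show ?thesis by simp
  qed
  show "(\<lambda>i. \<phi> i \<odot>\<^bsub>M\<^esub> t i) \<in> S \<rightarrow> carrier M" using terms_closed[OF assms(1,3)] .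
qed (use assms in simp_all)

lemma lin_comb_smult:
  assumes c: "c \<in> carrier R" and p: "\<phi> \<in> coeffs R I"
  shows "c \<odot>\<^bsub>M\<^esub> lin_comb R M t \<phi> \<in> lin_comb R M t ` coeffs R I"
proof -
  let ?S = "{i. \<phi> i \<noteq> \<zero>}" and ?\<psi> = "\<lambda>i. c \<otimes> \<phi> i"
  note d = coeffsD[OF p]
  have sub: "{i. ?\<psi> i \<noteq> \<zero>} \<subseteq> ?S" using c by auto
  have q: "?\<psi> \<in> coeffs R I"
    by (rule coeffsI[OF _ sub d(3,2)]) (simp add: c d(1))
  have "lin_comb R M t ?\<psi> = finsum M (\<lambda>i. ?\<psi> i \<odot>\<^bsub>M\<^esub> t i) ?S"
    by (rule lin_comb_eq[OF q d(3,2) sub])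
  also have "\<dots> = finsum M (\<lambda>i. c \<odot>\<^bsub>M\<^esub> (\<phi> i \<odot>\<^bsub>M\<^esub> t i)) ?S"
  proof (rule M.finsum_cong')
    show "?\<psi> i \<odot>\<^bsub>M\<^esub> t i = c \<odot>\<^bsub>M\<^esub> (\<phi> i \<odot>\<^bsub>M\<^esub> t i)" if "i \<in> ?S" for i
    proof -
      have "t i \<in> carrier M" using that d(2) t by blast
      then show ?thesis using smult_assoc1[OF c d(1)] by simp
    qed
    show "(\<lambda>i. c \<odot>\<^bsub>M\<^esub> (\<phi> i \<odot>\<^bsub>M\<^esub> t i)) \<in> ?S \<rightarrow> carrier M"
      by (intro funcsetI smult_closed[OF c] term_closed[OF p] subsetD[OF d(2)])
  qed simp
  also have "\<dots> = c \<odot>\<^bsub>M\<^esub> lin_comb R M t \<phi>"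
    unfolding lin_comb_def by (rule finsum_smult_ldistr[symmetric, OF d(3) c terms_closed[OF p d(2)]])
  finally show ?thesis using q by (metis (no_types, lifting) image_eqI)
qed

lemma lin_comb_add:
  assumes p: "\<phi> \<in> coeffs R I" and q: "\<psi> \<in> coeffs R I"
  shows "lin_comb R M t \<phi> \<oplus>\<^bsub>M\<^esub> lin_comb R M t \<psi> \<in> lin_comb R M t ` coeffs R I"
proof -
  let ?S = "{i. \<phi> i \<noteq> \<zero>} \<union> {i. \<psi> i \<noteq> \<zero>}" and ?\<chi> = "\<lambda>i. \<phi> i \<oplus> \<psi> i"
  note d = coeffsD[OF p] note e = coeffsD[OF q]
  have S: "finite ?S" "?S \<subseteq> I" using d e by blast+
  have sub: "{i. ?\<chi> i \<noteq> \<zero>} \<subseteq> ?S" by auto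
  have r: "?\<chi> \<in> coeffs R I"
    by (rule coeffsI[OF _ sub S]) (simp add: d(1) e(1))
  have "lin_comb R M t ?\<chi> = finsum M (\<lambda>i. ?\<chi> i \<odot>\<^bsub>M\<^esub> t i) ?S"
    by (rule lin_comb_eq[OF r S sub])
  also have "\<dots> = finsum M (\<lambda>i. \<phi> i \<odot>\<^bsub>M\<^esub> t i \<oplus>\<^bsub>M\<^esub> \<psi> i \<odot>\<^bsub>M\<^esub> t i) ?S"
  proof (rule M.finsum_cong')
    show "?\<chi> i \<odot>\<^bsub>M\<^esub> t i = \<phi> i \<odot>\<^bsub>M\<^esub> t i \<oplus>\<^bsub>M\<^esub> \<psi> i \<odot>\<^bsub>M\<^esub> t i" if "i \<in> ?S" for i
    proof -
      have "t i \<in> carrier M" using that S(2) t by blast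
      then show ?thesis using smult_l_distr[OF d(1) e(1)] by simp
    qed
    show "(\<lambda>i. \<phi> i \<odot>\<^bsub>M\<^esub> t i \<oplus>\<^bsub>M\<^esub> \<psi> i \<odot>\<^bsub>M\<^esub> t i) \<in> ?S \<rightarrow> carrier M"
      by (intro funcsetI M.a_closed term_closed[OF p] term_closed[OF q] subsetD[OF S(2)])
  qed simp
  also have "\<dots> = finsum M (\<lambda>i. \<phi> i \<odot>\<^bsub>M\<^esub> t i) ?S \<oplus>\<^bsub>M\<^esub> finsum M (\<lambda>i. \<psi> i \<odot>\<^bsub>M\<^esub> t i) ?S"
    by (rule M.finsum_addf[OF terms_closed[OF p S(2)] terms_closed[OF q S(2)]])
  also have "\<dots> = lin_comb R M t \<phi> \<oplus>\<^bsub>M\<^esub> lin_comb R M t \<psi>"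
    by (simp only: lin_comb_eq[OF p S Un_upper1] lin_comb_eq[OF q S Un_upper2])
  finally show ?thesis using r by (metis (no_types, lifting) image_eqI)
qed

lemma lin_comb_unit:
  assumes i: "i \<in> I" shows "t i \<in> lin_comb R M t ` coeffs R I"
proof -
  have sub: "{j. free_gen R i j \<noteq> \<zero>} \<subseteq> {i}" by (auto simp: free_gen_def)
  have p: "free_gen R i \<in> coeffs R I"
    by (rule coeffsI[OF _ sub]) (use i in \<open>auto simp: free_gen_def\<close>)
  have "t i \<in> carrier M" using t i by auto
  then have "lin_comb R M t (free_gen R i) = t i"
    using i lin_comb_eq[OF p _ _ sub] by (simp add: free_gen_def)
  then show ?thesis using p by (metis image_eqI)
qed

lemma lin_span_lin_comb: "lin_span R M (t ` I) \<subseteq> lin_comb R M t ` coeffs R I"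
proof (rule lin_span_least)
  show "t ` I \<subseteq> lin_comb R M t ` coeffs R I" using lin_comb_unit by blast
  show "submodule (lin_comb R M t ` coeffs R I) R M"
  proof (rule submoduleI)
    show "lin_comb R M t ` coeffs R I \<subseteq> carrier M" using lin_comb_closed by blast
    have "(\<lambda>_. \<zero>) \<in> coeffs R I" by (simp add: coeffs_def)
    moreover have "lin_comb R M t (\<lambda>_. \<zero>) = \<zero>\<^bsub>M\<^esub>" by (simp add: lin_comb_def)
    ultimately show "\<zero>\<^bsub>M\<^esub> \<in> lin_comb R M t ` coeffs R I" by (metis image_eqI)
    show "c \<odot>\<^bsub>M\<^esub> a \<in> lin_comb R M t ` coeffs R I" if "c \<in> carrier R" "a \<in> lin_comb R M t ` coeffs R I" for c a
      using that lin_comb_smult by blast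
    show "a \<oplus>\<^bsub>M\<^esub> b \<in> lin_comb R M t ` coeffs R I"
      if "a \<in> lin_comb R M t ` coeffs R I" "b \<in> lin_comb R M t ` coeffs R I" for a b
      using that lin_comb_add by blast
    show "\<ominus>\<^bsub>M\<^esub> a \<in> lin_comb R M t ` coeffs R I" if a: "a \<in> lin_comb R M t ` coeffs R I" for a
    proof -
      obtain \<phi> where p: "\<phi> \<in> coeffs R I" "a = lin_comb R M t \<phi>" using a by blast
      have "\<ominus>\<^bsub>M\<^esub> a = \<ominus> \<one> \<odot>\<^bsub>M\<^esub> a" using lin_comb_closed[OF p(1)] p(2) by (simp add: smult_l_minus)
      then show ?thesis using lin_comb_smult[OF _ p(1), of "\<ominus> \<one>"] p(2) by simp
    qed
  qed
qed

end

end

context leibniz_algebra begin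

lemma bracket_zero_left: "x \<in> carrier Q \<Longrightarrow> bracket Q \<zero>\<^bsub>Q\<^esub> x = \<zero>\<^bsub>Q\<^esub>"
  using bracket_smult_left[of "\<zero>" "\<zero>\<^bsub>Q\<^esub>" x] bracket_closed by simp

lemma bracket_zero_right: "x \<in> carrier Q \<Longrightarrow> bracket Q x \<zero>\<^bsub>Q\<^esub> = \<zero>\<^bsub>Q\<^esub>"
  using bracket_smult_right[of "\<zero>" x "\<zero>\<^bsub>Q\<^esub>"] bracket_closed by simp

lemma bracket_minus_left: "x \<in> carrier Q \<Longrightarrow> y \<in> carrier Q \<Longrightarrow> bracket Q (\<ominus>\<^bsub>Q\<^esub> x) y = \<ominus>\<^bsub>Q\<^esub> bracket Q x y"
  using bracket_smult_left[of "\<ominus> \<one>" x y] bracket_closed by (simp add: smult_l_minus)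

lemma bracket_minus_right: "x \<in> carrier Q \<Longrightarrow> y \<in> carrier Q \<Longrightarrow> bracket Q x (\<ominus>\<^bsub>Q\<^esub> y) = \<ominus>\<^bsub>Q\<^esub> bracket Q x y"
  using bracket_smult_right[of "\<ominus> \<one>" x y] bracket_closed by (simp add: smult_l_minus)

lemma sym_bracket_add_left:
  assumes "x \<in> carrier Q" "y \<in> carrier Q" "z \<in> carrier Q"
  shows "sym_bracket Q (x \<oplus>\<^bsub>Q\<^esub> y) z = sym_bracket Q x z \<oplus>\<^bsub>Q\<^esub> sym_bracket Q y z"
  unfolding sym_bracket_def using assms
  by (simp add: bracket_add_left bracket_add_right bracket_closed M.a_ac)

lemma submodule_zero: "submodule H K Q \<Longrightarrow> \<zero>\<^bsub>Q\<^esub> \<in> H"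
  using submodule.axioms(1) subgroup.one_closed by fastforce

lemma submodule_minus: "submodule H K Q \<Longrightarrow> a \<in> H \<Longrightarrow> b \<in> H \<Longrightarrow> a \<ominus>\<^bsub>Q\<^esub> b \<in> H"
  unfolding a_minus_def by (simp add: submoduleE)

lemma submodule_bracket_preimage_left:
  assumes "submodule H K Q" "y \<in> carrier Q"
  shows "submodule {u \<in> carrier Q. bracket Q u y \<in> H} K Q"
  using assms by (intro submoduleI)
    (auto simp: bracket_zero_left submodule_zero bracket_minus_left bracket_add_left
       bracket_smult_left submoduleE)

lemma submodule_bracket_preimage_right:
  assumes "submodule H K Q" "y \<in> carrier Q"
  shows "submodule {u \<in> carrier Q. bracket Q y u \<in> H} K Q"
  using assms by (intro submoduleI)
    (auto simp: bracket_zero_right submodule_zero bracket_minus_right bracket_add_right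
       bracket_smult_right submoduleE)

lemma subalgebra:
  assumes H: "submodule H K Q" and cl: "\<And>x y. x \<in> H \<Longrightarrow> y \<in> H \<Longrightarrow> bracket Q x y \<in> H"
  shows "leibniz_algebra K (Q\<lparr>carrier := H\<rparr>)"
proof -
  interpret H: module K "Q\<lparr>carrier := H\<rparr>"
    using submodule.submodule_is_module[OF H] module_axioms by blast
  have sub: "\<And>x. x \<in> H \<Longrightarrow> x \<in> carrier Q" using submoduleE(1)[OF H] by auto
  have inv: "\<ominus>\<^bsub>Q\<lparr>carrier := H\<rparr>\<^esub> x = \<ominus>\<^bsub>Q\<^esub> x" if "x \<in> H" for x
  proof -
    have "\<ominus>\<^bsub>Q\<^esub> x \<in> H" using submoduleE(3)[OF H that] .
    moreover have "x \<oplus>\<^bsub>Q\<^esub> \<ominus>\<^bsub>Q\<^esub> x = \<zero>\<^bsub>Q\<^esub>" using sub[OF that] by (simp add: r_neg)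
    ultimately show ?thesis using H.minus_equality[of "\<ominus>\<^bsub>Q\<^esub> x" x] that sub by (simp add: l_neg)
  qed
  show ?thesis
  proof (intro leibniz_algebra.intro leibniz_algebra_axioms.intro H.module_axioms, goal_cases)
    case (6 x y z)
    then show ?case
      using leibniz_identity[of x y z] sub inv cl by (simp add: a_minus_def)
  qed (use sub cl in \<open>auto simp: bracket_add_left bracket_add_right bracket_smult_left bracket_smult_right\<close>)
qed

end

primrec left_normed :: "('k, 'g) leibniz \<Rightarrow> ('a \<Rightarrow> 'g) \<Rightarrow> 'a list \<Rightarrow> 'g" where
  "left_normed G h [] = \<zero>\<^bsub>G\<^esub>"
| "left_normed G h (x # w) = (if w = [] then h x else bracket G (left_normed G h w) (h x))"

definition word_span :: "('k, 'r) ring_scheme \<Rightarrow> ('k, 'g) leibniz \<Rightarrow> ('a \<Rightarrow> 'g) \<Rightarrow> 'a set \<Rightarrow> 'g set" where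
  "word_span K G h X = lin_span K G (left_normed G h ` lists X)"

context leibniz_algebra begin

lemma left_normed_closed:
  assumes "h \<in> X \<rightarrow> carrier Q" shows "w \<in> lists X \<Longrightarrow> left_normed Q h w \<in> carrier Q"
  proof (induction w)
  case (Cons x w)
  then have "h x \<in> carrier Q" "left_normed Q h w \<in> carrier Q" using assms by auto
  then show ?case by (simp add: bracket_closed)
qed simp

context
  fixes h :: "'e \<Rightarrow> 'q" and X :: "'e set"
  assumes h: "h \<in> X \<rightarrow> carrier Q"
begin

lemma word_span_submodule: "submodule (word_span K Q h X) K Q"
  unfolding word_span_def using left_normed_closed[OF h] by (intro lin_span_submodule) blast

lemma word_span_carrier: "word_span K Q h X \<subseteq> carrier Q"
  using submoduleE(1)[OF word_span_submodule] .

lemma word_span_least: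
  "submodule H K Q \<Longrightarrow> (\<And>w. w \<in> lists X \<Longrightarrow> left_normed Q h w \<in> H) \<Longrightarrow> word_span K Q h X \<subseteq> H"
  unfolding word_span_def by (rule lin_span_least) (simp_all add: image_subsetI)

lemma word_in_span: "w \<in> lists X \<Longrightarrow> left_normed Q h w \<in> word_span K Q h X"
  unfolding word_span_def using lin_span_base[of "left_normed Q h ` lists X" K Q] by auto

lemma gen_in_span: "x \<in> X \<Longrightarrow> h x \<in> word_span K Q h X"
  using word_in_span[of "[x]"] by simp

lemma word_span_bracket_gen:
  assumes "x \<in> X" "u \<in> word_span K Q h X"
  shows "bracket Q u (h x) \<in> word_span K Q h X"
proof -
  have hx: "h x \<in> carrier Q" using assms h by auto
  have "word_span K Q h X \<subseteq> {u \<in> carrier Q. bracket Q u (h x) \<in> word_span K Q h X}"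
  proof (rule word_span_least[OF submodule_bracket_preimage_left[OF word_span_submodule hx]])
      fix w assume w: "w \<in> lists X"
      have "bracket Q (left_normed Q h w) (h x) \<in> word_span K Q h X"
      proof (cases "w = []")
        case True then show ?thesis using hx by (simp add: bracket_zero_left submodule_zero[OF word_span_submodule])
      next
        case False then show ?thesis using word_in_span[of "x # w"] w assms(1) by simp
      qed
      then show "left_normed Q h w \<in> {u \<in> carrier Q. bracket Q u (h x) \<in> word_span K Q h X}"
        using left_normed_closed[OF h w] by simp
  qed
  then show ?thesis using assms by auto
qed

lemma word_span_bracket_word:
  "w \<in> lists X \<Longrightarrow> u \<in> word_span K Q h X \<Longrightarrow> bracket Q u (left_normed Q h w) \<in> word_span K Q h X"
proof (induction w arbitrary: u)
  case Nil
  then show ?case using word_span_carrier by (auto simp: bracket_zero_right submodule_zero[OF word_span_submodule])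
next
  case (Cons x w)
  have c: "u \<in> carrier Q" "h x \<in> carrier Q" "left_normed Q h w \<in> carrier Q"
    using Cons.prems word_span_carrier h left_normed_closed[OF h] by auto
  have x: "x \<in> X" "w \<in> lists X" using Cons.prems by auto
  show ?case
    using Cons.IH[OF x(2)] Cons.prems(2) word_span_bracket_gen[OF x(1)] leibniz_identity[OF c(1,3,2)]
    by (auto intro: submodule_minus[OF word_span_submodule])
qed

lemma word_span_bracket:
  assumes "u \<in> word_span K Q h X" "v \<in> word_span K Q h X"
  shows "bracket Q u v \<in> word_span K Q h X"
proof -
  have u: "u \<in> carrier Q" using assms word_span_carrier by auto
  have "word_span K Q h X \<subseteq> {v \<in> carrier Q. bracket Q u v \<in> word_span K Q h X}"
    by (rule word_span_least[OF submodule_bracket_preimage_right[OF word_span_submodule u]])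
      (use word_span_bracket_word[OF _ assms(1)] left_normed_closed[OF h] in blast)
  then show ?thesis using assms by auto
qed

lemma word_span_leibniz: "leibniz_algebra K (Q\<lparr>carrier := word_span K Q h X\<rparr>)"
  using subalgebra[OF word_span_submodule word_span_bracket] .

lemma word_span_embedding: "\<exists>\<iota> :: 'q \<Rightarrow> ('e list \<Rightarrow> 'k). inj_on \<iota> (word_span K Q h X)"
proof -
  have "left_normed Q h \<in> lists X \<rightarrow> carrier Q" using left_normed_closed[OF h] by (rule funcsetI)
  from lin_span_lin_comb[OF this] show ?thesis
    unfolding word_span_def using inj_on_inv_into by blast
qed

end

end

definition transport_leibniz :: "('a \<Rightarrow> 'b) \<Rightarrow> ('k, 'a) leibniz \<Rightarrow> ('k, 'b) leibniz" where
  "transport_leibniz \<iota> G = (let j = the_inv_into (carrier G) \<iota> in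
    \<lparr>carrier = \<iota> ` carrier G, mult = undefined, one = undefined,
     zero = \<iota> \<zero>\<^bsub>G\<^esub>, add = (\<lambda>x y. \<iota> (j x \<oplus>\<^bsub>G\<^esub> j y)), smult = (\<lambda>c x. \<iota> (c \<odot>\<^bsub>G\<^esub> j x)),
     bracket = (\<lambda>x y. \<iota> (bracket G (j x) (j y)))\<rparr>)"

lemma (in leibniz_algebra) transport:
  assumes inj: "inj_on \<iota> (carrier Q)"
  defines "T \<equiv> transport_leibniz \<iota> Q"
  shows "leibniz_algebra K T" "\<iota> \<in> leibniz_hom K Q T" 
    "the_inv_into (carrier Q) \<iota> \<in> leibniz_hom K T Q" "carrier T = \<iota> ` carrier Q"
proof -
  let ?j = "the_inv_into (carrier Q) \<iota>"
  have j: "\<And>x. x \<in> carrier Q \<Longrightarrow> ?j (\<iota> x) = x" using inj by (simp add: the_inv_into_f_f)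
  have T: "carrier T = \<iota> ` carrier Q" "zero T = \<iota> \<zero>\<^bsub>Q\<^esub>" 
    "\<And>x y. add T x y = \<iota> (?j x \<oplus>\<^bsub>Q\<^esub> ?j y)" "\<And>c x. smult T c x = \<iota> (c \<odot>\<^bsub>Q\<^esub> ?j x)"
    "\<And>x y. bracket T x y = \<iota> (bracket Q (?j x) (?j y))"
    by (simp_all add: T_def transport_leibniz_def Let_def)
  show "carrier T = \<iota> ` carrier Q" by (rule T)
  have ag: "abelian_group T"
  proof (rule abelian_groupI)
    show "\<exists>y\<in>carrier T. y \<oplus>\<^bsub>T\<^esub> x = \<zero>\<^bsub>T\<^esub>" if x: "x \<in> carrier T" for x
    proof -
      obtain u where "u \<in> carrier Q" "x = \<iota> u" using x T by auto
      then show ?thesis unfolding T by (intro bexI[of _ "\<iota> (\<ominus>\<^bsub>Q\<^esub> u)"]) (auto simp: j l_neg)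
    qed
  qed (auto simp: T j M.a_ac)
  have md: "module K T"
    by (rule moduleI[OF R.is_cring ag]) (auto simp: T j smult_l_distr smult_r_distr smult_assoc1)
  interpret T: module K T by (rule md)
  have inv: "\<ominus>\<^bsub>T\<^esub> (\<iota> x) = \<iota> (\<ominus>\<^bsub>Q\<^esub> x)" if "x \<in> carrier Q" for x
    by (rule T.minus_equality) (use that in \<open>auto simp: T j l_neg\<close>)
  show "leibniz_algebra K T"
  proof (intro leibniz_algebra.intro leibniz_algebra_axioms.intro md, goal_cases)
    case (6 x y z)
    then show ?case
      using leibniz_identity inv by (auto simp: T j bracket_closed a_minus_def)
  qed (auto simp: T j bracket_closed bracket_add_left bracket_add_right bracket_smult_left bracket_smult_right)
  show "\<iota> \<in> leibniz_hom K Q T"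
    unfolding leibniz_hom_def linear_hom_def by (auto simp: T j)
  show "?j \<in> leibniz_hom K T Q"
    unfolding leibniz_hom_def linear_hom_def by (auto simp: T j bracket_closed)
qed

lemma leibniz_hom_comp:
  "f \<in> leibniz_hom K G H \<Longrightarrow> g \<in> leibniz_hom K H L \<Longrightarrow> g \<circ> f \<in> leibniz_hom K G L"
  unfolding leibniz_hom_def linear_hom_def by (auto simp: Pi_iff)

lemma leibniz_hom_closed: "f \<in> leibniz_hom K G H \<Longrightarrow> x \<in> carrier G \<Longrightarrow> f x \<in> carrier H"
  unfolding leibniz_hom_def linear_hom_def by auto

lemma leibniz_hom_restrict:
  "f \<in> leibniz_hom K G H \<Longrightarrow> S \<subseteq> carrier G \<Longrightarrow> f \<in> leibniz_hom K (G\<lparr>carrier := S\<rparr>) H"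
  unfolding leibniz_hom_def linear_hom_def by (auto simp: subset_iff)

lemma leibniz_hom_extend:
  "f \<in> leibniz_hom K H (G\<lparr>carrier := S\<rparr>) \<Longrightarrow> S \<subseteq> carrier G \<Longrightarrow> f \<in> leibniz_hom K H G"
  unfolding leibniz_hom_def linear_hom_def by (auto simp: subset_iff)

lemma leibniz_hom_zero:
  assumes "leibniz_algebra K G" "leibniz_algebra K H" "f \<in> leibniz_hom K G H"
  shows "f \<zero>\<^bsub>G\<^esub> = \<zero>\<^bsub>H\<^esub>"
proof -
  interpret G: leibniz_algebra K G by fact
  interpret H: leibniz_algebra K H by fact
  have "f (\<zero>\<^bsub>K\<^esub> \<odot>\<^bsub>G\<^esub> \<zero>\<^bsub>G\<^esub>) = \<zero>\<^bsub>K\<^esub> \<odot>\<^bsub>H\<^esub> f \<zero>\<^bsub>G\<^esub>"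
    using assms(3) unfolding leibniz_hom_def linear_hom_def by blast
  then show ?thesis using leibniz_hom_closed[OF assms(3)] by simp
qed

lemma a_kernel_iff: "x \<in> a_kernel G H f \<longleftrightarrow> x \<in> carrier G \<and> f x = \<zero>\<^bsub>H\<^esub>"
  by (simp add: a_kernel_def kernel_def)

lemma precise_lie_center_universal:
  fixes G :: "('k, 'g) leibniz" and Q :: "('k, 'q) leibniz"
  assumes ext: "lie_central_extension K G Q f"
  shows "precise_lie_center K Q \<subseteq> f ` lie_center G"
proof -
  have LG: "leibniz_algebra K G" and LQ: "leibniz_algebra K Q" and f: "f \<in> leibniz_hom K G Q"
    and surj: "f ` carrier G = carrier Q" and ker: "a_kernel G Q f \<subseteq> lie_center G"
    using ext unfolding lie_central_extension_def by auto
  interpret G: leibniz_algebra K G by (rule LG)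
  interpret Q: leibniz_algebra K Q by (rule LQ)
  define h where "h = inv_into (carrier G) f"
  have h: "h \<in> carrier Q \<rightarrow> carrier G" unfolding h_def using surj by (auto intro: inv_into_into)
  have fh: "f (h q) = q" if "q \<in> carrier Q" for q
    unfolding h_def using that surj by (simp add: f_inv_into_f)
  define H where "H = word_span K G h (carrier Q)"
  note H_sub = G.word_span_submodule[OF h, folded H_def]
  have H_car: "H \<subseteq> carrier G" using G.word_span_carrier[OF h] H_def by simp
  define G1 where "G1 = G\<lparr>carrier := H\<rparr>"
  have LG1: "leibniz_algebra K G1" unfolding G1_def H_def by (rule G.word_span_leibniz[OF h])
  interpret G1: leibniz_algebra K G1 by (rule LG1)
  have c1: "carrier G1 = H" and sb1: "sym_bracket G1 = sym_bracket G" and z1: "\<zero>\<^bsub>G1\<^esub> = \<zero>\<^bsub>G\<^esub>"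
    unfolding G1_def by (auto simp: sym_bracket_def fun_eq_iff)
  have f1: "f \<in> leibniz_hom K G1 Q" unfolding G1_def by (rule leibniz_hom_restrict[OF f H_car])
  have hH: "h q \<in> H" if "q \<in> carrier Q" for q using G.gen_in_span[OF h that] H_def by simp
  obtain \<iota> :: "'g \<Rightarrow> 'q list \<Rightarrow> 'k" where \<iota>: "inj_on \<iota> (carrier G1)"
    using G.word_span_embedding[OF h] c1 H_def by auto
  define T where "T = transport_leibniz \<iota> G1"
  define j where "j = the_inv_into (carrier G1) \<iota>"
  note tr = G1.transport[OF \<iota>, folded T_def j_def]
  have LT: "leibniz_algebra K T" by (rule tr(1))
  interpret T: leibniz_algebra K T by (rule LT)
  have j: "j (\<iota> x) = x" if "x \<in> H" for x unfolding j_def using \<iota> c1 that by (simp add: the_inv_into_f_f)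
  have fj: "f \<circ> j \<in> leibniz_hom K T Q" by (rule leibniz_hom_comp[OF tr(3) f1])
  have sbT: "sym_bracket T (\<iota> x) (\<iota> y) = \<iota> (sym_bracket G x y)" if "x \<in> H" "y \<in> H" for x y
    unfolding sb1[symmetric] sym_bracket_def
    using tr(2) that c1 G1.bracket_closed unfolding leibniz_hom_def linear_hom_def by auto
  have zT: "\<zero>\<^bsub>T\<^esub> = \<iota> \<zero>\<^bsub>G\<^esub>" using leibniz_hom_zero[OF LG1 LT tr(2)] z1 by simp
  have zH: "\<zero>\<^bsub>G\<^esub> \<in> H" using G.submodule_zero[OF H_sub] .
  have sbH: "sym_bracket G x y \<in> H" if "x \<in> H" "y \<in> H" for x y
    unfolding sym_bracket_def using that G.word_span_bracket[OF h] G.submoduleE(5)[OF H_sub]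
    unfolding H_def by blast
  have centerT: "\<iota> z \<in> lie_center T \<longleftrightarrow> (\<forall>x\<in>H. sym_bracket G x z = \<zero>\<^bsub>G\<^esub>)" if z: "z \<in> H" for z
  proof -
    have "\<iota> z \<in> carrier T" using tr(4) c1 z by auto
    then have "\<iota> z \<in> lie_center T \<longleftrightarrow> (\<forall>x\<in>H. \<iota> (sym_bracket G x z) = \<iota> \<zero>\<^bsub>G\<^esub>)"
      unfolding lie_center_def using tr(4) c1 sbT z zT by auto
    then show ?thesis using inj_on_eq_iff[OF \<iota>] sbH z zH c1 by auto
  qed
  have extT: "lie_central_extension K T Q (f \<circ> j)"
    unfolding lie_central_extension_def
  proof (intro conjI LT LQ fj)
    show "(f \<circ> j) ` carrier T = carrier Q"
    proof
      show "(f \<circ> j) ` carrier T \<subseteq> carrier Q" using leibniz_hom_closed[OF fj] by auto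
      show "carrier Q \<subseteq> (f \<circ> j) ` carrier T"
      proof
        fix q assume q: "q \<in> carrier Q"
        have "(f \<circ> j) (\<iota> (h q)) = q" using j hH[OF q] fh[OF q] by simp
        moreover have "\<iota> (h q) \<in> carrier T" using tr(4) c1 hH[OF q] by auto
        ultimately show "q \<in> (f \<circ> j) ` carrier T" by (metis image_eqI)
      qed
    qed
    show "a_kernel T Q (f \<circ> j) \<subseteq> lie_center T"
    proof
      fix t assume t: "t \<in> a_kernel T Q (f \<circ> j)"
      then obtain z where z: "z \<in> H" "t = \<iota> z" using tr(4) c1 by (auto simp: a_kernel_iff)
      then have "z \<in> a_kernel G Q f" using t H_car j by (auto simp: a_kernel_iff)
      then have "z \<in> lie_center G" using ker by blast
      then have "\<forall>x\<in>H. sym_bracket G x z = \<zero>\<^bsub>G\<^esub>" using H_car unfolding lie_center_def by blast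
      then show "t \<in> lie_center T" using z centerT by blast
    qed
  qed
  have "(f \<circ> j) ` lie_center T \<subseteq> f ` lie_center G"
  proof clarify
    fix t assume t: "t \<in> lie_center T"
    then obtain z where z: "z \<in> H" "t = \<iota> z" using tr(4) c1 by (auto simp: lie_center_def)
    have zc: "z \<in> carrier G" using z H_car by auto
    have 1: "\<forall>x\<in>H. sym_bracket G x z = \<zero>\<^bsub>G\<^esub>" using centerT z t by simp
    have "sym_bracket G x z = \<zero>\<^bsub>G\<^esub>" if x: "x \<in> carrier G" for x
    proof -
      let ?y = "h (f x)"
      have fx: "f x \<in> carrier Q" using leibniz_hom_closed[OF f x] .
      have y: "?y \<in> H" "?y \<in> carrier G" using hH[OF fx] H_car by auto
      have add: "f (a \<oplus>\<^bsub>G\<^esub> b) = f a \<oplus>\<^bsub>Q\<^esub> f b" if "a \<in> carrier G" "b \<in> carrier G" for a b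
        using f that unfolding leibniz_hom_def linear_hom_def by auto
      define k where "k = x \<ominus>\<^bsub>G\<^esub> ?y"
      have k: "k \<in> carrier G" "x = k \<oplus>\<^bsub>G\<^esub> ?y" unfolding k_def using x y
        by (auto simp: a_minus_def G.M.a_assoc G.M.l_neg)
      have "f k \<oplus>\<^bsub>Q\<^esub> f x = f x" using add[OF k(1) y(2)] k(2) fh[OF fx] by simp
      then have "f k = \<zero>\<^bsub>Q\<^esub>" using leibniz_hom_closed[OF f k(1)] fx
        by (metis Q.M.add.r_cancel_one')
      then have "k \<in> lie_center G" using ker k by (auto simp: a_kernel_iff)
      then have kz: "sym_bracket G k z = \<zero>\<^bsub>G\<^esub>"
        using zc k(1) G.bracket_closed by (auto simp: lie_center_def sym_bracket_def G.M.a_comm)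
      have yz: "sym_bracket G ?y z = \<zero>\<^bsub>G\<^esub>" using 1 y by auto
      have "sym_bracket G x z = sym_bracket G k z \<oplus>\<^bsub>G\<^esub> sym_bracket G ?y z"
        using G.sym_bracket_add_left[OF k(1) y(2) zc] k(2) by simp
      then show ?thesis using kz yz by simp
    qed
    then have "z \<in> lie_center G" using zc by (auto simp: lie_center_def)
    then show "(f \<circ> j) t \<in> f ` lie_center G" using z j by auto
  qed
  moreover have "precise_lie_center K Q \<subseteq> (f \<circ> j) ` lie_center T"
    unfolding precise_lie_center_def using extT by blast
  ultimately show ?thesis by blast
qed

lemma free_leibniz_on_universal:
  fixes K :: "('k, 'r) ring_scheme" and F :: "('k, 'f) leibniz" and L :: "('k, 'l) leibniz"
  assumes K: "field K" and free: "free_leibniz_on K F X" and LL: "leibniz_algebra K L" and h: "h \<in> X \<rightarrow> carrier L"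
  shows "\<exists>\<phi>\<in>leibniz_hom K F L. (\<forall>x\<in>X. \<phi> x = h x) \<and>
           (\<forall>\<psi>\<in>leibniz_hom K F L. (\<forall>x\<in>X. \<psi> x = h x) \<longrightarrow> (\<forall>u\<in>carrier F. \<psi> u = \<phi> u))"
proof -
  interpret K: field K by (rule K)
  have LF: "leibniz_algebra K F" and XF: "X \<subseteq> carrier F"
    and univ: "\<And>(L :: ('k, 'f list \<Rightarrow> 'k) leibniz) h. leibniz_algebra K L \<Longrightarrow> h \<in> X \<rightarrow> carrier L \<Longrightarrow>
        \<exists>\<phi>\<in>leibniz_hom K F L. (\<forall>x\<in>X. \<phi> x = h x) \<and>
           (\<forall>\<psi>\<in>leibniz_hom K F L. (\<forall>x\<in>X. \<psi> x = h x) \<longrightarrow> (\<forall>u\<in>carrier F. \<psi> u = \<phi> u))"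
    using free unfolding free_leibniz_on_def by blast+
  interpret F: leibniz_algebra K F by (rule LF)
  have ex: "\<exists>\<phi>\<in>leibniz_hom K F L. (\<forall>x\<in>X. \<phi> x = h x) \<and> \<phi> ` carrier F \<subseteq> word_span K L h X"
    if LL: "leibniz_algebra K L" and h: "h \<in> X \<rightarrow> carrier L" for L :: "('k, 'm) leibniz" and h
  proof -
    interpret L: leibniz_algebra K L by (rule LL)
    define H where "H = word_span K L h X"
    define L1 where "L1 = L\<lparr>carrier := H\<rparr>"
    have c1: "carrier L1 = H" unfolding L1_def by simp
    have LL1: "leibniz_algebra K L1" unfolding L1_def H_def by (rule L.word_span_leibniz[OF h])
    interpret L1: leibniz_algebra K L1 by (rule LL1)
    obtain \<iota> :: "'m \<Rightarrow> 'f list \<Rightarrow> 'k" where \<iota>: "inj_on \<iota> (carrier L1)"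
      using L.word_span_embedding[OF h] c1 H_def by auto
    define T where "T = transport_leibniz \<iota> L1"
    define j where "j = the_inv_into (carrier L1) \<iota>"
    note tr = L1.transport[OF \<iota>, folded T_def j_def]
    have hH: "h x \<in> H" if "x \<in> X" for x using L.gen_in_span[OF h that] H_def by simp
    have "(\<lambda>x. \<iota> (h x)) \<in> X \<rightarrow> carrier T" using tr(4) c1 hH by auto
    from univ[OF tr(1) this] obtain \<phi> where \<phi>: "\<phi> \<in> leibniz_hom K F T" "\<forall>x\<in>X. \<phi> x = \<iota> (h x)" by blast
    have jphi: "j \<circ> \<phi> \<in> leibniz_hom K F L1" by (rule leibniz_hom_comp[OF \<phi>(1) tr(3)])
    have "j \<circ> \<phi> \<in> leibniz_hom K F L" 
      using leibniz_hom_extend[OF jphi[unfolded L1_def]] L.word_span_carrier[OF h] H_def by simp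
    moreover have "\<forall>x\<in>X. (j \<circ> \<phi>) x = h x"
      using \<phi>(2) hH \<iota> c1 by (auto simp: j_def the_inv_into_f_f)
    moreover have "(j \<circ> \<phi>) ` carrier F \<subseteq> H" using leibniz_hom_closed[OF jphi] c1 by blast
    ultimately show ?thesis using H_def by blast
  qed
  \<comment> \<open>the generators span: the retraction onto the subalgebra they generate is the identity\<close>
  have idX: "(\<lambda>x. x) \<in> X \<rightarrow> carrier F" using XF by auto
  obtain e where e: "e \<in> leibniz_hom K F F" "\<forall>x\<in>X. e x = x" "e ` carrier F \<subseteq> word_span K F (\<lambda>x. x) X"
    using ex[OF LF idX] by blast
  define \<iota> :: "'f \<Rightarrow> 'f list \<Rightarrow> 'k" where "\<iota> x = free_gen K [x]" for x
  have inj: "inj_on \<iota> (carrier F)"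
    unfolding \<iota>_def free_gen_def by (rule inj_onI) (metis K.zero_not_one list.inject)
  define T where "T = transport_leibniz \<iota> F"
  note tr = F.transport[OF inj, folded T_def]
  have "\<iota> \<in> X \<rightarrow> carrier T" using tr(4) XF by auto
  from univ[OF tr(1) this] obtain \<theta> where \<theta>:
    "\<forall>\<psi>\<in>leibniz_hom K F T. (\<forall>x\<in>X. \<psi> x = \<iota> x) \<longrightarrow> (\<forall>u\<in>carrier F. \<psi> u = \<theta> u)" by blast
  have "\<iota> (e u) = \<iota> u" if "u \<in> carrier F" for u
  proof -
    have "\<forall>x\<in>X. (\<iota> \<circ> e) x = \<iota> x" using e(2) by simp
    then have "(\<iota> \<circ> e) u = \<theta> u" using bspec[OF \<theta> leibniz_hom_comp[OF e(1) tr(2)]] that by blast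
    moreover have "\<iota> u = \<theta> u" using bspec[OF \<theta> tr(2)] that by blast
    ultimately show ?thesis by simp
  qed
  then have eid: "e u = u" if "u \<in> carrier F" for u
    using that inj_onD[OF inj] leibniz_hom_closed[OF e(1)] by blast
  have gen: "carrier F \<subseteq> word_span K F (\<lambda>x. x) X"
  proof
    fix u assume "u \<in> carrier F"
    then show "u \<in> word_span K F (\<lambda>x. x) X" using e(3) eid by (metis image_subset_iff)
  qed
  have uniq: "\<psi> u = \<phi> u"
    if p: "\<phi> \<in> leibniz_hom K F L" and q: "\<psi> \<in> leibniz_hom K F L" and eq: "\<forall>x\<in>X. \<psi> x = \<phi> x" and u: "u \<in> carrier F"
    for \<phi> \<psi> u
  proof -
    interpret L: leibniz_algebra K L by (rule LL)
    let ?E = "{u \<in> carrier F. \<psi> u = \<phi> u}"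
    have add: "\<And>a b. a \<in> carrier F \<Longrightarrow> b \<in> carrier F \<Longrightarrow> \<phi> (a \<oplus>\<^bsub>F\<^esub> b) = \<phi> a \<oplus>\<^bsub>L\<^esub> \<phi> b"
       "\<And>a b. a \<in> carrier F \<Longrightarrow> b \<in> carrier F \<Longrightarrow> \<psi> (a \<oplus>\<^bsub>F\<^esub> b) = \<psi> a \<oplus>\<^bsub>L\<^esub> \<psi> b"
      and sm: "\<And>c b. c \<in> carrier K \<Longrightarrow> b \<in> carrier F \<Longrightarrow> \<phi> (c \<odot>\<^bsub>F\<^esub> b) = c \<odot>\<^bsub>L\<^esub> \<phi> b"
       "\<And>c b. c \<in> carrier K \<Longrightarrow> b \<in> carrier F \<Longrightarrow> \<psi> (c \<odot>\<^bsub>F\<^esub> b) = c \<odot>\<^bsub>L\<^esub> \<psi> b"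
      and br: "\<And>a b. a \<in> carrier F \<Longrightarrow> b \<in> carrier F \<Longrightarrow> \<phi> (bracket F a b) = bracket L (\<phi> a) (\<phi> b)"
       "\<And>a b. a \<in> carrier F \<Longrightarrow> b \<in> carrier F \<Longrightarrow> \<psi> (bracket F a b) = bracket L (\<psi> a) (\<psi> b)"
      using p q unfolding leibniz_hom_def linear_hom_def by auto
    have z: "\<phi> \<zero>\<^bsub>F\<^esub> = \<zero>\<^bsub>L\<^esub>" "\<psi> \<zero>\<^bsub>F\<^esub> = \<zero>\<^bsub>L\<^esub>" using leibniz_hom_zero[OF LF LL p] leibniz_hom_zero[OF LF LL q] .
    have subm: "submodule ?E K F"
    proof (rule F.submoduleI)
      show "\<ominus>\<^bsub>F\<^esub> a \<in> ?E" if "a \<in> ?E" for a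
      proof -
        have "\<ominus>\<^bsub>F\<^esub> a = \<ominus>\<^bsub>K\<^esub> \<one>\<^bsub>K\<^esub> \<odot>\<^bsub>F\<^esub> a" using that by (simp add: F.smult_l_minus)
        then show ?thesis using that sm[of "\<ominus>\<^bsub>K\<^esub> \<one>\<^bsub>K\<^esub>" a] by simp
      qed
    qed (auto simp: z add sm)
    have "left_normed F (\<lambda>x. x) w \<in> ?E" if "w \<in> lists X" for w
      using that by (induction w) (use z eq XF F.bracket_closed in \<open>auto simp: br\<close>)
    then have "word_span K F (\<lambda>x. x) X \<subseteq> ?E"
      unfolding word_span_def by (intro lin_span_least[OF subm]) blast
    then show ?thesis using gen u by blast
  qed
  obtain \<phi> where \<phi>: "\<phi> \<in> leibniz_hom K F L" "\<forall>x\<in>X. \<phi> x = h x" using ex[OF LL h] by blast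
  then show ?thesis using uniq by (intro bexI[of _ \<phi>]) auto
qed

end

theory Submission
  imports Defs
begin

text \<open>
  Let \<open>F \<rightarrow> Q\<close> be the free presentation \<open>\<rho>\<close> with kernel \<open>R\<close>, and put \<open>N = [R, F]\<^sub>L\<^sub>i\<^sub>e\<close>.  Both sides of
  the equivalence say the same thing about \<open>F\<close>, namely
  \<^item> (\<dagger>) \<open>[s, y] + [y, s] \<in> N\<close> whenever \<open>s, y \<in> F\<close> and \<open>\<rho> s \<in> A\<close>.

  For the precise center this is \<open>subset_precise_lie_center_iff\<close>.  The subspace \<open>N\<close> is a two-sided
  ideal contained in \<open>R\<close>, and \<open>F/N \<rightarrow> Q\<close> is a Lie-central extension; it is the most
  restrictive one.  Indeed, an element \<open>z + N\<close> is Lie-central in \<open>F/N\<close> exactly if all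
  \<open>[x, z] + [z, x]\<close> lie in \<open>N\<close>, and this does not change when \<open>z\<close> is moved by an element of \<open>R\<close>.
  So \<open>A\<close> is contained in the image of the Lie-center of \<open>F/N\<close> exactly if (\<dagger>) holds.  If (\<dagger>) holds
  and \<open>f: G \<rightarrow> Q\<close> is any Lie-central extension, freeness lifts \<open>\<rho>\<close> to \<open>\<phi>: F \<rightarrow> G\<close>.  The lift
  sends \<open>R\<close> into \<open>ker f\<close>, hence kills \<open>N\<close>, so \<open>\<phi> s\<close> is Lie-central against \<open>\<phi> F\<close> for \<open>\<rho> s \<in> A\<close>;
  since \<open>G = \<phi> F + ker f\<close>, it is Lie-central in \<open>G\<close>, and it lies over \<open>\<rho> s\<close>.

  For the map \<open>C\<close>, the values on pure tensors are the classes of \<open>[s, y] + [y, s]\<close> modulo \<open>N\<close>, so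
  (\<dagger>) says that \<open>C\<close> vanishes on pure tensors; as these span the tensor product
  (\<open>is_zero_map_tensor\<close>), it says that \<open>C\<close> is zero.  Conversely, under (\<dagger>) all these classes vanish,
  so the zero map satisfies the formula that characterizes \<open>C\<close>, and \<open>C\<close> exists.
\<close>

section \<open>Quotient modules\<close>

context module begin

context
  fixes N assumes N: "submodule N R M"
begin

interpretation N: abelian_subgroup N M
  by (intro abelian_subgroupI3 additive_subgroup.intro submodule.axioms(1)[OF N] M.abelian_group_axioms)

lemma coset_eq_iff:
  assumes "x \<in> carrier M" "y \<in> carrier M"
  shows "N +>\<^bsub>M\<^esub> x = N +>\<^bsub>M\<^esub> y \<longleftrightarrow> x \<ominus>\<^bsub>M\<^esub> y \<in> N"
proof -
  have "N +>\<^bsub>M\<^esub> x = N +>\<^bsub>M\<^esub> y \<longleftrightarrow> x \<in> N +>\<^bsub>M\<^esub> y"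
    using N.a_rcos_self[OF assms(1)] N.a_repr_independence'[of x y] assms(2) by auto
  then show ?thesis unfolding a_minus_def by (simp only: N.a_rcos_module[OF assms(2,1)])
qed

lemma coset_eq_submodule_iff:
  assumes "x \<in> carrier M"
  shows "N +>\<^bsub>M\<^esub> x = N \<longleftrightarrow> x \<in> N"
  using N.a_rcos_self[OF assms] N.a_rcos_const[of x] by auto

lemma carrier_quot_module: "carrier (quot_module M N) = (\<lambda>x. N +>\<^bsub>M\<^esub> x) ` carrier M"
  unfolding quot_module_def A_RCOSETS_def' by auto

lemma zero_quot_module: "\<zero>\<^bsub>quot_module M N\<^esub> = N"
  unfolding quot_module_def by simp

lemma add_quot_module:
  assumes "x \<in> carrier M" "y \<in> carrier M"
  shows "(N +>\<^bsub>M\<^esub> x) \<oplus>\<^bsub>quot_module M N\<^esub> (N +>\<^bsub>M\<^esub> y) = N +>\<^bsub>M\<^esub> (x \<oplus>\<^bsub>M\<^esub> y)"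
  unfolding quot_module_def using N.a_rcos_sum[OF assms] by simp

lemma coset_subset_carrier: "x \<in> carrier M \<Longrightarrow> u \<in> N +>\<^bsub>M\<^esub> x \<Longrightarrow> u \<in> carrier M"
  using M.a_r_coset_subset_G[of N x] submoduleE(1)[OF N] by blast

lemma coset_memD: "x \<in> carrier M \<Longrightarrow> u \<in> N +>\<^bsub>M\<^esub> x \<Longrightarrow> u \<ominus>\<^bsub>M\<^esub> x \<in> N"
  unfolding a_minus_def by (rule N.a_rcos_module_imp)

lemma coset_self: "x \<in> carrier M \<Longrightarrow> x \<in> N +>\<^bsub>M\<^esub> x"
  by (rule N.a_rcos_self)

lemma smult_quot_module:
  assumes c: "c \<in> carrier R" and x: "x \<in> carrier M"
  shows "c \<odot>\<^bsub>quot_module M N\<^esub> (N +>\<^bsub>M\<^esub> x) = N +>\<^bsub>M\<^esub> (c \<odot>\<^bsub>M\<^esub> x)"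
proof -
  have "N +>\<^bsub>M\<^esub> (c \<odot>\<^bsub>M\<^esub> u) = N +>\<^bsub>M\<^esub> (c \<odot>\<^bsub>M\<^esub> x)" if u: "u \<in> N +>\<^bsub>M\<^esub> x" for u
  proof -
    have uc: "u \<in> carrier M" using coset_subset_carrier[OF x u] .
    have "c \<odot>\<^bsub>M\<^esub> u \<ominus>\<^bsub>M\<^esub> c \<odot>\<^bsub>M\<^esub> x = c \<odot>\<^bsub>M\<^esub> (u \<ominus>\<^bsub>M\<^esub> x)"
      using c x uc by (simp add: a_minus_def smult_r_distr smult_r_minus)
    then show ?thesis using coset_eq_iff c x uc submoduleE(4)[OF N c coset_memD[OF x u]] by simp
  qed
  then have "(\<Union>u\<in>N +>\<^bsub>M\<^esub> x. N +>\<^bsub>M\<^esub> (c \<odot>\<^bsub>M\<^esub> u)) = N +>\<^bsub>M\<^esub> (c \<odot>\<^bsub>M\<^esub> x)"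
    by (intro UN_constant_eq[OF coset_self[OF x]] ballI)
  then show ?thesis by (simp add: quot_module_def)
qed

lemma module_quot_module: "module R (quot_module M N)"
proof -
  have zero: "\<zero>\<^bsub>quot_module M N\<^esub> = N +>\<^bsub>M\<^esub> \<zero>\<^bsub>M\<^esub>"
    using coset_eq_submodule_iff[of "\<zero>\<^bsub>M\<^esub>"] N.zero_closed by (simp add: zero_quot_module)
  show ?thesis
  proof (rule moduleI[OF R.is_cring abelian_groupI], unfold carrier_quot_module zero)
    fix X Y Z assume "X \<in> (+>\<^bsub>M\<^esub>) N ` carrier M" "Y \<in> (+>\<^bsub>M\<^esub>) N ` carrier M" "Z \<in> (+>\<^bsub>M\<^esub>) N ` carrier M"
    then obtain x y z where c: "x \<in> carrier M" "y \<in> carrier M" "z \<in> carrier M"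
      and XYZ: "X = N +>\<^bsub>M\<^esub> x" "Y = N +>\<^bsub>M\<^esub> y" "Z = N +>\<^bsub>M\<^esub> z" by blast
    show "X \<oplus>\<^bsub>quot_module M N\<^esub> Y \<in> (+>\<^bsub>M\<^esub>) N ` carrier M"
      using c by (simp add: XYZ add_quot_module)
    show "X \<oplus>\<^bsub>quot_module M N\<^esub> Y \<oplus>\<^bsub>quot_module M N\<^esub> Z = X \<oplus>\<^bsub>quot_module M N\<^esub> (Y \<oplus>\<^bsub>quot_module M N\<^esub> Z)"
      using c by (simp add: XYZ add_quot_module M.a_assoc)
    show "X \<oplus>\<^bsub>quot_module M N\<^esub> Y = Y \<oplus>\<^bsub>quot_module M N\<^esub> X"
      using c by (simp add: XYZ add_quot_module M.a_comm)
    show "(N +>\<^bsub>M\<^esub> \<zero>\<^bsub>M\<^esub>) \<oplus>\<^bsub>quot_module M N\<^esub> X = X"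
      using c by (simp add: XYZ add_quot_module del: M.a_coset_add_zero)
    show "\<exists>Y\<in>(+>\<^bsub>M\<^esub>) N ` carrier M. Y \<oplus>\<^bsub>quot_module M N\<^esub> X = N +>\<^bsub>M\<^esub> \<zero>\<^bsub>M\<^esub>"
      using c by (intro bexI[of _ "N +>\<^bsub>M\<^esub> (\<ominus>\<^bsub>M\<^esub> x)"])
        (simp_all add: XYZ add_quot_module M.l_neg del: M.a_coset_add_zero)
    show "\<one> \<odot>\<^bsub>quot_module M N\<^esub> X = X"
      using c by (simp add: XYZ smult_quot_module)
    fix a b assume ab: "a \<in> carrier R" "b \<in> carrier R"
    show "a \<odot>\<^bsub>quot_module M N\<^esub> X \<in> (+>\<^bsub>M\<^esub>) N ` carrier M"
      using c ab by (simp add: XYZ smult_quot_module)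
    show "(a \<oplus> b) \<odot>\<^bsub>quot_module M N\<^esub> X = a \<odot>\<^bsub>quot_module M N\<^esub> X \<oplus>\<^bsub>quot_module M N\<^esub> b \<odot>\<^bsub>quot_module M N\<^esub> X"
      using c ab by (simp add: XYZ smult_quot_module add_quot_module smult_l_distr)
    show "a \<odot>\<^bsub>quot_module M N\<^esub> (X \<oplus>\<^bsub>quot_module M N\<^esub> Y) = a \<odot>\<^bsub>quot_module M N\<^esub> X \<oplus>\<^bsub>quot_module M N\<^esub> a \<odot>\<^bsub>quot_module M N\<^esub> Y"
      using c ab by (simp add: XYZ smult_quot_module add_quot_module smult_r_distr)
    show "a \<otimes> b \<odot>\<^bsub>quot_module M N\<^esub> X = a \<odot>\<^bsub>quot_module M N\<^esub> (b \<odot>\<^bsub>quot_module M N\<^esub> X)"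
      using c ab by (simp add: XYZ smult_quot_module smult_assoc1)
  qed simp
qed

end

lemma submodule_of_submodule:
  assumes "submodule N R M" "submodule H R M" "N \<subseteq> H"
  shows "submodule N R (M\<lparr>carrier := H\<rparr>)"
  unfolding submodule_def submodule_axioms_def
  using M.add.subgroup_incl[OF submodule.axioms(1)[OF assms(1)] submodule.axioms(1)[OF assms(2)] assms(3)]
    submoduleE(4)[OF assms(1)] 
  by simp

lemma submodule_Int:
  assumes "submodule H R M" "submodule H' R M" shows "submodule (H \<inter> H') R M"
  unfolding submodule_def submodule_axioms_def
  using M.add.subgroups_Inter_pair[OF submodule.axioms(1)[OF assms(1)] submodule.axioms(1)[OF assms(2)]]
   submoduleE(4)[OF assms(1)]  submoduleE(4)[OF assms(2)] by simp

end

text \<open>The module structure of a quotient algebra is copied from the quotient module along this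
  change of record type.\<close>

lemma module_cong:
  assumes "module K M" "carrier L = carrier M" "\<zero>\<^bsub>L\<^esub> = \<zero>\<^bsub>M\<^esub>" "add L = add M" "smult L = smult M"
  shows "module K L"
proof -
  interpret module K M by fact
  show ?thesis
  proof (rule moduleI[OF R.is_cring abelian_groupI])
    show "\<exists>y\<in>carrier L. y \<oplus>\<^bsub>L\<^esub> x = \<zero>\<^bsub>L\<^esub>" if "x \<in> carrier L" for x
      using that M.l_neg unfolding assms(2-5) by (intro bexI[of _ "\<ominus>\<^bsub>M\<^esub> x"]) simp_all
  next
    fix x y z assume xyz: "x \<in> carrier L" "y \<in> carrier L" "z \<in> carrier L"
    show "x \<oplus>\<^bsub>L\<^esub> y \<in> carrier L" using xyz unfolding assms(2-5) by simp
    show "x \<oplus>\<^bsub>L\<^esub> y \<oplus>\<^bsub>L\<^esub> z = x \<oplus>\<^bsub>L\<^esub> (y \<oplus>\<^bsub>L\<^esub> z)"  using xyz unfolding assms(2-5) by (simp add: M.a_assoc)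
    show "x \<oplus>\<^bsub>L\<^esub> y = y \<oplus>\<^bsub>L\<^esub> x" using xyz unfolding assms(2-5) by (simp add: M.a_comm)
    show "\<zero>\<^bsub>L\<^esub> \<oplus>\<^bsub>L\<^esub> x = x" using xyz unfolding assms(2-5) by simp
  next
    show "\<zero>\<^bsub>L\<^esub> \<in> carrier L" unfolding assms(2-5) by simp
  qed (unfold assms(2-5); simp only: smult_closed smult_l_distr smult_r_distr smult_assoc1 smult_one)+
qed


section \<open>Homomorphisms, ideals and quotients of Leibniz algebras\<close>

lemma leibniz_homD:
  assumes "f \<in> leibniz_hom K G H"
  shows "x \<in> carrier G \<Longrightarrow> y \<in> carrier G \<Longrightarrow> f (x \<oplus>\<^bsub>G\<^esub> y) = f x \<oplus>\<^bsub>H\<^esub> f y"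
    and "c \<in> carrier K \<Longrightarrow> x \<in> carrier G \<Longrightarrow> f (c \<odot>\<^bsub>G\<^esub> x) = c \<odot>\<^bsub>H\<^esub> f x"
    and "x \<in> carrier G \<Longrightarrow> y \<in> carrier G \<Longrightarrow> f (bracket G x y) = bracket H (f x) (f y)"
  using assms unfolding leibniz_hom_def linear_hom_def by auto

lemma leibniz_hom_sym_bracket:
  assumes "leibniz_algebra K G" "f \<in> leibniz_hom K G H" "x \<in> carrier G" "y \<in> carrier G"
  shows "f (sym_bracket G x y) = sym_bracket H (f x) (f y)"
  using assms leibniz_algebra.bracket_closed[OF assms(1)]
  by (simp add: sym_bracket_def leibniz_homD[OF assms(2)])

lemma leibniz_hom_minus:
  assumes G: "leibniz_algebra K G" and H: "leibniz_algebra K H" and f: "f \<in> leibniz_hom K G H"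
    and x: "x \<in> carrier G" and y: "y \<in> carrier G"
  shows "f (x \<ominus>\<^bsub>G\<^esub> y) = f x \<ominus>\<^bsub>H\<^esub> f y"
proof -
  interpret G: leibniz_algebra K G by fact
  interpret H: leibniz_algebra K H by fact
  have "\<ominus>\<^bsub>G\<^esub> y = \<ominus>\<^bsub>K\<^esub> \<one>\<^bsub>K\<^esub> \<odot>\<^bsub>G\<^esub> y" using y by (simp add: G.smult_l_minus)
  then have "f (\<ominus>\<^bsub>G\<^esub> y) = \<ominus>\<^bsub>H\<^esub> f y"
    using y leibniz_homD(2)[OF f, of "\<ominus>\<^bsub>K\<^esub> \<one>\<^bsub>K\<^esub>" y] leibniz_hom_closed[OF f y]
    by (simp add: H.smult_l_minus)
  then show ?thesis using x y by (simp add: a_minus_def leibniz_homD(1)[OF f])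
qed

lemma leibniz_ideal_kernel:
  assumes G: "leibniz_algebra K G" and H: "leibniz_algebra K H" and f: "f \<in> leibniz_hom K G H"
  shows "leibniz_ideal K G (a_kernel G H f)"
proof -
  interpret G: leibniz_algebra K G by fact
  interpret H: leibniz_algebra K H by fact
  note hom = leibniz_homD[OF f] leibniz_hom_zero[OF G H f] leibniz_hom_closed[OF f]
  have "submodule (a_kernel G H f) K G"
  proof (rule G.submoduleI)
    show "\<ominus>\<^bsub>G\<^esub> a \<in> a_kernel G H f" if "a \<in> a_kernel G H f" for a
      using that leibniz_hom_minus[OF G H f, of "\<zero>\<^bsub>G\<^esub>" a] hom(4)
      by (auto simp: a_kernel_iff a_minus_def)
  qed (auto simp: a_kernel_iff hom)
  then show ?thesis
    unfolding leibniz_ideal_def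
    by (auto simp: a_kernel_iff hom G.bracket_closed H.bracket_zero_left H.bracket_zero_right)
qed

context leibniz_algebra begin

lemma sym_bracket_closed:
  "x \<in> carrier Q \<Longrightarrow> y \<in> carrier Q \<Longrightarrow> sym_bracket Q x y \<in> carrier Q"
  by (simp add: sym_bracket_def bracket_closed)

lemma sym_bracket_commute:
  "x \<in> carrier Q \<Longrightarrow> y \<in> carrier Q \<Longrightarrow> sym_bracket Q x y = sym_bracket Q y x"
  by (simp add: sym_bracket_def bracket_closed M.a_comm)

context
  fixes I assumes I: "leibniz_ideal K Q I"
begin

lemma ideal_submodule: "submodule I K Q"
  using I unfolding leibniz_ideal_def by blast

lemma carrier_quot_leibniz: "carrier (quot_leibniz Q I) = (\<lambda>x. I +>\<^bsub>Q\<^esub> x) ` carrier Q"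
  using carrier_quot_module[OF ideal_submodule] by (simp add: quot_leibniz_def module.defs leibniz.defs)

lemma zero_quot_leibniz: "\<zero>\<^bsub>quot_leibniz Q I\<^esub> = I"
  by (simp add: quot_leibniz_def module.defs quot_module_def)

lemma add_quot_leibniz:
  "x \<in> carrier Q \<Longrightarrow> y \<in> carrier Q \<Longrightarrow>
    (I +>\<^bsub>Q\<^esub> x) \<oplus>\<^bsub>quot_leibniz Q I\<^esub> (I +>\<^bsub>Q\<^esub> y) = I +>\<^bsub>Q\<^esub> (x \<oplus>\<^bsub>Q\<^esub> y)"
  using add_quot_module[OF ideal_submodule] by (simp add: quot_leibniz_def module.defs)

lemma smult_quot_leibniz:
  "c \<in> carrier K \<Longrightarrow> x \<in> carrier Q \<Longrightarrow>
    c \<odot>\<^bsub>quot_leibniz Q I\<^esub> (I +>\<^bsub>Q\<^esub> x) = I +>\<^bsub>Q\<^esub> (c \<odot>\<^bsub>Q\<^esub> x)"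
  using smult_quot_module[OF ideal_submodule] by (simp add: quot_leibniz_def module.defs)

lemma bracket_quot_leibniz:
  assumes x: "x \<in> carrier Q" and y: "y \<in> carrier Q"
  shows "bracket (quot_leibniz Q I) (I +>\<^bsub>Q\<^esub> x) (I +>\<^bsub>Q\<^esub> y) = I +>\<^bsub>Q\<^esub> bracket Q x y"
proof -
  note sub = ideal_submodule
  have "I +>\<^bsub>Q\<^esub> bracket Q u v = I +>\<^bsub>Q\<^esub> bracket Q x y"
    if u: "u \<in> I +>\<^bsub>Q\<^esub> x" and v: "v \<in> I +>\<^bsub>Q\<^esub> y" for u v
  proof -
    have c: "u \<in> carrier Q" "v \<in> carrier Q"
      using coset_subset_carrier[OF sub] x y u v by blast+
    have d: "u \<ominus>\<^bsub>Q\<^esub> x \<in> I" "v \<ominus>\<^bsub>Q\<^esub> y \<in> I"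
      using coset_memD[OF sub] x y u v by blast+
    have "bracket Q (u \<ominus>\<^bsub>Q\<^esub> x) v = bracket Q u v \<ominus>\<^bsub>Q\<^esub> bracket Q x v"
      and "bracket Q x (v \<ominus>\<^bsub>Q\<^esub> y) = bracket Q x v \<ominus>\<^bsub>Q\<^esub> bracket Q x y"
      using c x y by (simp_all add: a_minus_def bracket_add_left bracket_add_right
          bracket_minus_left bracket_minus_right)
    then have "bracket Q u v \<ominus>\<^bsub>Q\<^esub> bracket Q x v \<in> I" "bracket Q x v \<ominus>\<^bsub>Q\<^esub> bracket Q x y \<in> I"
      using d c x I unfolding leibniz_ideal_def by metis+
    then show ?thesis using coset_eq_iff[OF sub] bracket_closed c x y by metis
  qed
  then have "(\<Union>v\<in>I +>\<^bsub>Q\<^esub> y. I +>\<^bsub>Q\<^esub> bracket Q u v) = I +>\<^bsub>Q\<^esub> bracket Q x y" if "u \<in> I +>\<^bsub>Q\<^esub> x" for u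
    using that by (intro UN_constant_eq[OF coset_self[OF sub y]] ballI)
  then have "(\<Union>u\<in>I +>\<^bsub>Q\<^esub> x. \<Union>v\<in>I +>\<^bsub>Q\<^esub> y. I +>\<^bsub>Q\<^esub> bracket Q u v) = I +>\<^bsub>Q\<^esub> bracket Q x y"
    by (intro UN_constant_eq[OF coset_self[OF sub x]] ballI)
  then show ?thesis by (simp add: quot_leibniz_def module.defs leibniz.defs)
qed

lemma module_quot_leibniz: "module K (quot_leibniz Q I)"
  by (rule module_cong[OF module_quot_module[OF ideal_submodule]])
    (simp_all add: quot_leibniz_def module.defs leibniz.defs)

lemma leibniz_algebra_quot: "leibniz_algebra K (quot_leibniz Q I)"
proof -
  interpret QI: module K "quot_leibniz Q I" by (rule module_quot_leibniz)
  have minus: "\<ominus>\<^bsub>quot_leibniz Q I\<^esub> (I +>\<^bsub>Q\<^esub> x) = I +>\<^bsub>Q\<^esub> (\<ominus>\<^bsub>Q\<^esub> x)" if x: "x \<in> carrier Q" for x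
    using QI.smult_l_minus[of "\<one>" "I +>\<^bsub>Q\<^esub> x"] smult_l_minus[of "\<one>" x] smult_quot_leibniz[of "\<ominus> \<one>" x] x
    by (simp add: carrier_quot_leibniz)
  show ?thesis
  proof (intro leibniz_algebra.intro leibniz_algebra_axioms.intro module_quot_leibniz, goal_cases)
    case (6 X Y Z)
    then obtain x y z where "x \<in> carrier Q" "y \<in> carrier Q" "z \<in> carrier Q"
      "X = I +>\<^bsub>Q\<^esub> x" "Y = I +>\<^bsub>Q\<^esub> y" "Z = I +>\<^bsub>Q\<^esub> z" by (auto simp: carrier_quot_leibniz)
    then show ?case
      by (simp add: bracket_quot_leibniz bracket_closed leibniz_identity a_minus_def minus add_quot_leibniz)
  qed (auto simp: carrier_quot_leibniz bracket_quot_leibniz bracket_closed add_quot_leibniz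
      smult_quot_leibniz bracket_add_left bracket_add_right bracket_smult_left bracket_smult_right)
qed

lemma sym_bracket_quot_leibniz:
  "x \<in> carrier Q \<Longrightarrow> y \<in> carrier Q \<Longrightarrow>
    sym_bracket (quot_leibniz Q I) (I +>\<^bsub>Q\<^esub> x) (I +>\<^bsub>Q\<^esub> y) = I +>\<^bsub>Q\<^esub> sym_bracket Q x y"
  by (simp add: sym_bracket_def bracket_quot_leibniz bracket_closed add_quot_leibniz)

lemma lie_center_quot_iff:
  assumes z: "z \<in> carrier Q"
  shows "I +>\<^bsub>Q\<^esub> z \<in> lie_center (quot_leibniz Q I) \<longleftrightarrow> (\<forall>x\<in>carrier Q. sym_bracket Q x z \<in> I)"
proof -
  have "I +>\<^bsub>Q\<^esub> z \<in> lie_center (quot_leibniz Q I) \<longleftrightarrow> (\<forall>x\<in>carrier Q. I +>\<^bsub>Q\<^esub> sym_bracket Q x z = I)"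
    using z by (simp add: lie_center_def carrier_quot_leibniz zero_quot_leibniz sym_bracket_quot_leibniz)
  then show ?thesis
    using z by (simp add: coset_eq_submodule_iff[OF ideal_submodule] sym_bracket_closed)
qed

text \<open>A homomorphism that vanishes on the ideal is constant on each coset, so its image of a coset
  is a singleton; \<open>the_elem\<close> extracts the induced value.\<close>

lemma quot_hom_value:
  assumes H: "leibniz_algebra K H" and f: "f \<in> leibniz_hom K Q H" and ker: "I \<subseteq> a_kernel Q H f"
    and x: "x \<in> carrier Q"
  shows "the_elem (f ` (I +>\<^bsub>Q\<^esub> x)) = f x"
proof -
  interpret H: leibniz_algebra K H by fact
  have "f u = f x" if u: "u \<in> I +>\<^bsub>Q\<^esub> x" for u
  proof -
    have c: "u \<in> carrier Q" using coset_subset_carrier[OF ideal_submodule x u] .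
    have "f u \<ominus>\<^bsub>H\<^esub> f x = \<zero>\<^bsub>H\<^esub>"
      using coset_memD[OF ideal_submodule x u] ker leibniz_hom_minus[OF leibniz_algebra_axioms H f c x]
      by (auto simp: a_kernel_iff)
    moreover have "f u = (f u \<ominus>\<^bsub>H\<^esub> f x) \<oplus>\<^bsub>H\<^esub> f x"
      using leibniz_hom_closed[OF f c] leibniz_hom_closed[OF f x] by (simp add: a_minus_def H.M.a_assoc H.M.l_neg)
    ultimately show ?thesis using leibniz_hom_closed[OF f x] by simp
  qed
  then have "f ` (I +>\<^bsub>Q\<^esub> x) \<subseteq> {f x}" by blast
  moreover have "f x \<in> f ` (I +>\<^bsub>Q\<^esub> x)" by (rule imageI[OF coset_self[OF ideal_submodule x]])
  ultimately have "f ` (I +>\<^bsub>Q\<^esub> x) = {f x}" by blast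
  then show ?thesis by simp
qed

lemma quot_hom:
  assumes H: "leibniz_algebra K H" and f: "f \<in> leibniz_hom K Q H" and ker: "I \<subseteq> a_kernel Q H f"
  shows "(\<lambda>X. the_elem (f ` X)) \<in> leibniz_hom K (quot_leibniz Q I) H"
  unfolding leibniz_hom_def linear_hom_def mem_Collect_eq Pi_iff carrier_quot_leibniz ball_simps
  by (simp add: quot_hom_value[OF assms] leibniz_homD[OF f] leibniz_hom_closed[OF f]
      add_quot_leibniz smult_quot_leibniz bracket_quot_leibniz bracket_closed)

end

text \<open>The elements whose brackets with a fixed \<open>y\<close> stay in a subspace form a subspace, so it
  suffices to test the ideal property on a spanning set.\<close>

lemma leibniz_ideal_lin_span:
  assumes S: "S \<subseteq> carrier Q"
    and l: "\<And>u y. u \<in> S \<Longrightarrow> y \<in> carrier Q \<Longrightarrow> bracket Q u y \<in> lin_span K Q S"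
    and r: "\<And>u y. u \<in> S \<Longrightarrow> y \<in> carrier Q \<Longrightarrow> bracket Q y u \<in> lin_span K Q S"
  shows "leibniz_ideal K Q (lin_span K Q S)"
  unfolding leibniz_ideal_def
proof (intro conjI ballI)
  note sub = lin_span_submodule[OF S]
  show "submodule (lin_span K Q S) K Q" by (rule sub)
  fix u y assume u: "u \<in> lin_span K Q S" and y: "y \<in> carrier Q"
  show "bracket Q u y \<in> lin_span K Q S"
    using lin_span_least[OF submodule_bracket_preimage_left[OF sub y], of S] S l y u by blast
  show "bracket Q y u \<in> lin_span K Q S"
    using lin_span_least[OF submodule_bracket_preimage_right[OF sub y], of S] S r y u by blast
qed

text \<open>The Leibniz identity, solved for the iterated left bracket: right multiplication by \<open>z\<close> is a
  derivation.\<close>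

lemma bracket_derivation:
  assumes "x \<in> carrier Q" "y \<in> carrier Q" "z \<in> carrier Q"
  shows "bracket Q (bracket Q x y) z = bracket Q x (bracket Q y z) \<oplus>\<^bsub>Q\<^esub> bracket Q (bracket Q x z) y"
  using assms by (simp add: leibniz_identity bracket_closed a_minus_def M.a_assoc M.l_neg)

lemma bracket_sym_bracket_left:
  assumes "x \<in> carrier Q" "y \<in> carrier Q" "z \<in> carrier Q"
  shows "bracket Q (sym_bracket Q x y) z =
    sym_bracket Q x (bracket Q y z) \<oplus>\<^bsub>Q\<^esub> sym_bracket Q (bracket Q x z) y"
  using assms bracket_derivation[OF assms] bracket_derivation[OF assms(2,1,3)]
  by (simp add: sym_bracket_def bracket_add_left bracket_closed M.a_ac)

text \<open>The two instances of the Leibniz identity differ by exchanging \<open>x\<close> and \<open>y\<close>, which is a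
  change of sign.\<close>

lemma bracket_sym_bracket_right:
  assumes "x \<in> carrier Q" "y \<in> carrier Q" "z \<in> carrier Q"
  shows "bracket Q z (sym_bracket Q x y) = \<zero>\<^bsub>Q\<^esub>"
proof -
  let ?a = "bracket Q (bracket Q z x) y" and ?b = "bracket Q (bracket Q z y) x"
  have c: "?a \<in> carrier Q" "?b \<in> carrier Q" using assms by (simp_all add: bracket_closed)
  have "bracket Q z (sym_bracket Q x y) = (?a \<ominus>\<^bsub>Q\<^esub> ?b) \<oplus>\<^bsub>Q\<^esub> (?b \<ominus>\<^bsub>Q\<^esub> ?a)"
    using assms by (simp add: sym_bracket_def bracket_add_right leibniz_identity bracket_closed)
  also have "\<dots> = (?a \<oplus>\<^bsub>Q\<^esub> \<ominus>\<^bsub>Q\<^esub> ?a) \<oplus>\<^bsub>Q\<^esub> (?b \<oplus>\<^bsub>Q\<^esub> \<ominus>\<^bsub>Q\<^esub> ?b)"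
    using c by (simp only: a_minus_def M.a_ac M.a_closed M.a_inv_closed)
  also have "\<dots> = \<zero>\<^bsub>Q\<^esub>" using c by (simp add: M.r_neg)
  finally show ?thesis .
qed

lemma sym_bracket_in_lie_commutator:
  "m \<in> I \<Longrightarrow> n \<in> J \<Longrightarrow> sym_bracket Q m n \<in> lie_commutator K Q I J"
  unfolding lie_commutator_def by (rule subsetD[OF lin_span_base]) blast

text \<open>Right multiplication is a derivation of the symmetrized bracket, so it sends a generator
  \<open>[m, n] + [n, m]\<close> to a sum of two generators, because \<open>[m, y]\<close> stays in the ideal; left
  multiplication annihilates all generators.\<close>

lemma leibniz_ideal_lie_commutator:
  assumes I: "leibniz_ideal K Q I"
  shows "leibniz_ideal K Q (lie_commutator K Q I (carrier Q))"
proof -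
  let ?S = "{sym_bracket Q m n | m n. m \<in> I \<and> n \<in> carrier Q}"
  have Ic: "x \<in> carrier Q" if "x \<in> I" for x using that submoduleE(1)[OF ideal_submodule[OF I]] by auto
  have S: "?S \<subseteq> carrier Q" using Ic sym_bracket_closed by auto
  note sub = lin_span_submodule[OF S]
  show ?thesis
    unfolding lie_commutator_def
  proof (rule leibniz_ideal_lin_span[OF S])
    fix u y assume "u \<in> ?S" and y: "y \<in> carrier Q"
    then obtain m n where u: "u = sym_bracket Q m n" and m: "m \<in> I" and n: "n \<in> carrier Q" by blast
    have "bracket Q m y \<in> I" using I m y unfolding leibniz_ideal_def by blast
    then have "sym_bracket Q m (bracket Q n y) \<in> ?S" "sym_bracket Q (bracket Q m y) n \<in> ?S"
      using m n y bracket_closed by blast+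
    then show "bracket Q u y \<in> lin_span K Q ?S"
      unfolding u bracket_sym_bracket_left[OF Ic[OF m] n y]
      using lin_span_base[of ?S K Q] submoduleE(5)[OF sub] by blast
    show "bracket Q y u \<in> lin_span K Q ?S"
      unfolding u bracket_sym_bracket_right[OF Ic[OF m] n y] by (rule submodule_zero[OF sub])
  qed
qed

text \<open>Left multiplication annihilates squares.  On the right, the derivation rule turns
  \<open>[[x, x], y]\<close> into \<open>[x, w] + [w, x]\<close> with \<open>w = [x, y]\<close>, and polarization writes this as a
  combination of the squares of \<open>x + w\<close>, \<open>x\<close> and \<open>w\<close>.\<close>

lemma leibniz_ideal_ann: "leibniz_ideal K Q (leibniz_ann K Q)"
proof -
  let ?S = "{bracket Q x x | x. x \<in> carrier Q}"
  have S: "?S \<subseteq> carrier Q" using bracket_closed by auto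
  note sub = lin_span_submodule[OF S]
  have base: "bracket Q x x \<in> lin_span K Q ?S" if "x \<in> carrier Q" for x
    using lin_span_base[of ?S K Q] that by blast
  show ?thesis
    unfolding leibniz_ann_def
  proof (rule leibniz_ideal_lin_span[OF S])
    fix u y assume "u \<in> ?S" and y: "y \<in> carrier Q"
    then obtain x where u: "u = bracket Q x x" and x: "x \<in> carrier Q" by blast
    let ?w = "bracket Q x y"
    have w: "?w \<in> carrier Q" using x y by (simp add: bracket_closed)
    have "bracket Q (x \<oplus>\<^bsub>Q\<^esub> ?w) (x \<oplus>\<^bsub>Q\<^esub> ?w) =
        bracket Q u y \<oplus>\<^bsub>Q\<^esub> (bracket Q x x \<oplus>\<^bsub>Q\<^esub> bracket Q ?w ?w)"
      unfolding u bracket_derivation[OF x x y]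
      using x w by (simp add: bracket_add_left bracket_add_right bracket_closed M.a_ac)
    then have "bracket Q u y = bracket Q (x \<oplus>\<^bsub>Q\<^esub> ?w) (x \<oplus>\<^bsub>Q\<^esub> ?w)
        \<ominus>\<^bsub>Q\<^esub> (bracket Q x x \<oplus>\<^bsub>Q\<^esub> bracket Q ?w ?w)"
      using x y w u by (simp add: bracket_closed a_minus_def M.a_assoc M.r_neg)
    then show "bracket Q u y \<in> lin_span K Q ?S"
      using base[of "x \<oplus>\<^bsub>Q\<^esub> ?w"] base[OF x] base[OF w] x w
      by (simp add: submodule_minus[OF sub] submoduleE(5)[OF sub])
    have "bracket Q y u = \<zero>\<^bsub>Q\<^esub>"
      unfolding u leibniz_identity[OF y x x] using x y by (simp add: bracket_closed a_minus_def M.r_neg)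
    then show "bracket Q y u \<in> lin_span K Q ?S" by (simp add: submodule_zero[OF sub])
  qed
qed

lemma lie_commutator_subset_ideal:
  assumes I: "leibniz_ideal K Q I"
  shows "lie_commutator K Q I (carrier Q) \<subseteq> I"
  unfolding lie_commutator_def
  using I submoduleE(5)[OF ideal_submodule[OF I]]
  by (intro lin_span_least[OF ideal_submodule[OF I]]) (auto simp: sym_bracket_def leibniz_ideal_def)

lemma lie_commutator_mono: "I \<subseteq> J \<Longrightarrow> lie_commutator K Q I (carrier Q) \<subseteq> lie_commutator K Q J (carrier Q)"
  unfolding lie_commutator_def lin_span_def by blast

end


section \<open>The precise Lie-center via a free presentation\<close>

text \<open>The ideal \<open>[R, F]\<^sub>L\<^sub>i\<^sub>e\<close> is by construction what must be factored out to make the image of the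
  kernel \<open>R\<close> Lie-central.\<close>

lemma lie_central_extension_quot:
  assumes F: "leibniz_algebra K F" and Q: "leibniz_algebra K Q"
    and \<rho>: "\<rho> \<in> leibniz_hom K F Q" and surj: "\<rho> ` carrier F = carrier Q"
  defines "N \<equiv> lie_commutator K F (a_kernel F Q \<rho>) (carrier F)"
  shows "lie_central_extension K (quot_leibniz F N) Q (\<lambda>X. the_elem (\<rho> ` X))"
proof -
  interpret F: leibniz_algebra K F by fact
  note R = leibniz_ideal_kernel[OF F Q \<rho>]
  have N: "leibniz_ideal K F N" unfolding N_def by (rule F.leibniz_ideal_lie_commutator[OF R])
  have ker: "N \<subseteq> a_kernel F Q \<rho>" unfolding N_def by (rule F.lie_commutator_subset_ideal[OF R])
  note val = F.quot_hom_value[OF N Q \<rho> ker]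
  show ?thesis
    unfolding lie_central_extension_def
  proof (intro conjI F.leibniz_algebra_quot[OF N] Q F.quot_hom[OF N Q \<rho> ker])
    show "(\<lambda>X. the_elem (\<rho> ` X)) ` carrier (quot_leibniz F N) = carrier Q"
      unfolding surj[symmetric] F.carrier_quot_leibniz[OF N] image_image
      by (rule image_cong[OF refl]) (rule val)
    show "a_kernel (quot_leibniz F N) Q (\<lambda>X. the_elem (\<rho> ` X)) \<subseteq> lie_center (quot_leibniz F N)"
    proof
      fix X assume "X \<in> a_kernel (quot_leibniz F N) Q (\<lambda>X. the_elem (\<rho> ` X))"
      then obtain r where r: "r \<in> carrier F" "X = N +>\<^bsub>F\<^esub> r" "\<rho> r = \<zero>\<^bsub>Q\<^esub>"
        by (auto simp: a_kernel_iff F.carrier_quot_leibniz[OF N] val)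
      then have "r \<in> a_kernel F Q \<rho>" by (simp add: a_kernel_iff)
      then have "sym_bracket F x r \<in> N" if "x \<in> carrier F" for x
        unfolding F.sym_bracket_commute[OF that r(1)] N_def
        using that by (rule F.sym_bracket_in_lie_commutator)
      then show "X \<in> lie_center (quot_leibniz F N)" using F.lie_center_quot_iff[OF N r(1)] r(2) by blast
    qed
  qed
qed

text \<open>Lift the images of the free generators arbitrarily and extend.  The composite with \<open>f\<close> agrees
  with \<open>\<rho>\<close> on the generators, hence everywhere by the uniqueness part of the universal property.\<close>

lemma free_presentation_lift:
  fixes K :: "('k, 'r) ring_scheme" and F :: "('k, 'f) leibniz" and G :: "('k, 'g) leibniz"
  assumes K: "field K" and pres: "free_presentation K F Q \<rho>"
    and G: "leibniz_algebra K G" and f: "f \<in> leibniz_hom K G Q" and surj: "f ` carrier G = carrier Q"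
  obtains \<phi> where "\<phi> \<in> leibniz_hom K F G" "\<And>u. u \<in> carrier F \<Longrightarrow> f (\<phi> u) = \<rho> u"
proof -
  obtain X where X: "free_leibniz_on K F X" and Q: "leibniz_algebra K Q" and \<rho>: "\<rho> \<in> leibniz_hom K F Q"
    using pres unfolding free_presentation_def by blast
  have XF: "X \<subseteq> carrier F" using X unfolding free_leibniz_on_def by blast
  have \<rho>X: "\<rho> x \<in> f ` carrier G" if "x \<in> X" for x using leibniz_hom_closed[OF \<rho>] XF surj that by blast
  define h where "h x = inv_into (carrier G) f (\<rho> x)" for x
  have h: "h \<in> X \<rightarrow> carrier G" and fh: "\<And>x. x \<in> X \<Longrightarrow> f (h x) = \<rho> x"
    using \<rho>X by (auto simp: h_def inv_into_into f_inv_into_f)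
  obtain \<phi> where \<phi>: "\<phi> \<in> leibniz_hom K F G" "\<forall>x\<in>X. \<phi> x = h x"
    using free_leibniz_on_universal[OF K X G h] by blast
  have "\<rho> \<in> X \<rightarrow> carrier Q" using leibniz_hom_closed[OF \<rho>] XF by blast
  from free_leibniz_on_universal[OF K X Q this] obtain \<theta> where
    \<theta>: "\<And>\<psi>. \<psi> \<in> leibniz_hom K F Q \<Longrightarrow> \<forall>x\<in>X. \<psi> x = \<rho> x \<Longrightarrow> \<forall>u\<in>carrier F. \<psi> u = \<theta> u" by blast
  have "\<forall>x\<in>X. (f \<circ> \<phi>) x = \<rho> x" using \<phi>(2) fh by simp
  from \<theta>[OF leibniz_hom_comp[OF \<phi>(1) f] this] \<theta>[OF \<rho>]
  have "f (\<phi> u) = \<rho> u" if "u \<in> carrier F" for u using that by simp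
  then show ?thesis using that \<phi>(1) by blast
qed

text \<open>Forwards, test the precise center on \<open>F/N\<close>: an element \<open>s\<close> over \<open>A\<close> differs by some element of
  \<open>R\<close> from a representative \<open>z\<close> of a Lie-central class, and elements of \<open>R\<close> have symmetrized
  brackets in \<open>N\<close>.  Backwards, a lift \<open>\<phi>\<close> of \<open>\<rho>\<close> to a given extension provides the
  Lie-central preimages \<open>\<phi> s\<close>.\<close>

theorem subset_precise_lie_center_iff:
  fixes K :: "('k, 'r) ring_scheme" and Q :: "('k, 'q) leibniz" and F :: "('k, 'f) leibniz"
  assumes K: "field K" and pres: "free_presentation K F Q \<rho>" and A: "A \<subseteq> carrier Q"
  defines "N \<equiv> lie_commutator K F (a_kernel F Q \<rho>) (carrier F)"
  shows "A \<subseteq> precise_lie_center K Q \<longleftrightarrow>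
    (\<forall>s\<in>carrier F. \<forall>y\<in>carrier F. \<rho> s \<in> A \<longrightarrow> sym_bracket F s y \<in> N)"
proof -
  have F: "leibniz_algebra K F" and Q: "leibniz_algebra K Q" and \<rho>: "\<rho> \<in> leibniz_hom K F Q"
    and surj: "\<rho> ` carrier F = carrier Q"
    using pres unfolding free_presentation_def free_leibniz_on_def by blast+
  interpret F: leibniz_algebra K F by (rule F)
  interpret Q: leibniz_algebra K Q by (rule Q)
  note R = leibniz_ideal_kernel[OF F Q \<rho>]
  have N: "leibniz_ideal K F N" unfolding N_def by (rule F.leibniz_ideal_lie_commutator[OF R])
  have ker: "N \<subseteq> a_kernel F Q \<rho>" unfolding N_def by (rule F.lie_commutator_subset_ideal[OF R])
  note subN = F.ideal_submodule[OF N]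
  show ?thesis
  proof
    assume "A \<subseteq> precise_lie_center K Q"
    then have A_im: "A \<subseteq> (\<lambda>X. the_elem (\<rho> ` X)) ` lie_center (quot_leibniz F N)"
      using precise_lie_center_universal[OF lie_central_extension_quot[OF F Q \<rho> surj]]
      unfolding N_def by blast
    show "\<forall>s\<in>carrier F. \<forall>y\<in>carrier F. \<rho> s \<in> A \<longrightarrow> sym_bracket F s y \<in> N"
    proof (intro ballI impI)
      fix s y assume s: "s \<in> carrier F" and y: "y \<in> carrier F" and "\<rho> s \<in> A"
      then obtain X where X: "X \<in> lie_center (quot_leibniz F N)" "\<rho> s = the_elem (\<rho> ` X)"
        using A_im by blast
      then obtain z where z: "z \<in> carrier F" "X = N +>\<^bsub>F\<^esub> z"
        unfolding lie_center_def by (auto simp: F.carrier_quot_leibniz[OF N])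
      have \<rho>z: "\<rho> s = \<rho> z" using X(2) F.quot_hom_value[OF N Q \<rho> ker z(1)] z(2) by simp
      have "sym_bracket F y z \<in> N" using F.lie_center_quot_iff[OF N z(1)] X(1) y z(2) by blast
      then have zy: "sym_bracket F z y \<in> N" using F.sym_bracket_commute[OF z(1) y] by simp
      have "\<rho> (s \<ominus>\<^bsub>F\<^esub> z) = \<zero>\<^bsub>Q\<^esub>"
        using leibniz_hom_minus[OF F Q \<rho> s z(1)] \<rho>z leibniz_hom_closed[OF \<rho> z(1)]
        by (simp add: a_minus_def Q.M.r_neg)
      then have "s \<ominus>\<^bsub>F\<^esub> z \<in> a_kernel F Q \<rho>" using s z(1) by (simp add: a_kernel_iff)
      then have dy: "sym_bracket F (s \<ominus>\<^bsub>F\<^esub> z) y \<in> N"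
        unfolding N_def using y by (rule F.sym_bracket_in_lie_commutator)
      have "s = (s \<ominus>\<^bsub>F\<^esub> z) \<oplus>\<^bsub>F\<^esub> z" using s z(1) by (simp add: a_minus_def F.M.a_assoc F.M.l_neg)
      then have "sym_bracket F s y = sym_bracket F (s \<ominus>\<^bsub>F\<^esub> z) y \<oplus>\<^bsub>F\<^esub> sym_bracket F z y"
        using F.sym_bracket_add_left[of "s \<ominus>\<^bsub>F\<^esub> z" z y] s z(1) y by simp
      then show "sym_bracket F s y \<in> N" using F.submoduleE(5)[OF subN dy zy] by simp
    qed
  next
    assume crit: "\<forall>s\<in>carrier F. \<forall>y\<in>carrier F. \<rho> s \<in> A \<longrightarrow> sym_bracket F s y \<in> N"
    show "A \<subseteq> precise_lie_center K Q"
      unfolding precise_lie_center_def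
    proof clarify
      fix a and G :: "('k, 'q list \<Rightarrow> 'k) leibniz" and f
      assume a: "a \<in> A" and ext: "lie_central_extension K G Q f"
      have G: "leibniz_algebra K G" and f: "f \<in> leibniz_hom K G Q" and fsurj: "f ` carrier G = carrier Q"
        and fker: "a_kernel G Q f \<subseteq> lie_center G"
        using ext unfolding lie_central_extension_def by auto
      interpret G: leibniz_algebra K G by (rule G)
      obtain \<phi> where \<phi>: "\<phi> \<in> leibniz_hom K F G" and f\<phi>: "\<And>u. u \<in> carrier F \<Longrightarrow> f (\<phi> u) = \<rho> u"
        using free_presentation_lift[OF K pres G f fsurj] by blast
      note \<phi>c = leibniz_hom_closed[OF \<phi>]
      have central: "sym_bracket G x k = \<zero>\<^bsub>G\<^esub>" if "x \<in> carrier G" "k \<in> carrier G" "f k = \<zero>\<^bsub>Q\<^esub>" for x k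
        using that fker by (auto simp: lie_center_def a_kernel_iff)
      \<comment> \<open>\<open>\<phi>\<close> sends \<open>R\<close> into the kernel of \<open>f\<close>, which is Lie-central\<close>
      have "N \<subseteq> a_kernel F G \<phi>"
        unfolding N_def lie_commutator_def
      proof (rule lin_span_least[OF F.ideal_submodule[OF leibniz_ideal_kernel[OF F G \<phi>]]], clarify)
        fix r y assume "r \<in> a_kernel F Q \<rho>" and y: "y \<in> carrier F"
        then have r: "r \<in> carrier F" "\<rho> r = \<zero>\<^bsub>Q\<^esub>" by (auto simp: a_kernel_iff)
        have "\<phi> (sym_bracket F r y) = sym_bracket G (\<phi> y) (\<phi> r)"
          using leibniz_hom_sym_bracket[OF F \<phi> r(1) y] G.sym_bracket_commute \<phi>c r(1) y by simp
        then show "sym_bracket F r y \<in> a_kernel F G \<phi>"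
          using central[OF \<phi>c[OF y] \<phi>c[OF r(1)]] f\<phi>[OF r(1)] r F.sym_bracket_closed[OF r(1) y]
          by (simp add: a_kernel_iff)
      qed
      then have kill: "\<phi> u = \<zero>\<^bsub>G\<^esub>" if "u \<in> N" for u using that by (auto simp: a_kernel_iff)
      obtain s where s: "s \<in> carrier F" "\<rho> s = a" using a A surj by (metis imageE subsetD)
      have "sym_bracket G g (\<phi> s) = \<zero>\<^bsub>G\<^esub>" if g: "g \<in> carrier G" for g
      proof -
        obtain y where y: "y \<in> carrier F" "\<rho> y = f g"
          using leibniz_hom_closed[OF f g] surj by (metis imageE)
        \<comment> \<open>\<open>\<phi>\<close> need not be onto, but \<open>G\<close> is the sum of its image and the Lie-central kernel of \<open>f\<close>\<close>
        define k where "k = g \<ominus>\<^bsub>G\<^esub> \<phi> y"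
        have k: "k \<in> carrier G" using g \<phi>c[OF y(1)] by (simp add: k_def)
        have "f k = \<zero>\<^bsub>Q\<^esub>"
          unfolding k_def leibniz_hom_minus[OF G Q f g \<phi>c[OF y(1)]] f\<phi>[OF y(1)] y(2)
          using leibniz_hom_closed[OF f g] by (simp add: a_minus_def Q.M.r_neg)
        then have "sym_bracket G k (\<phi> s) = \<zero>\<^bsub>G\<^esub>"
          using central[OF \<phi>c[OF s(1)] k] G.sym_bracket_commute[OF k \<phi>c[OF s(1)]] by simp
        moreover have "sym_bracket F y s \<in> N"
          using crit s y(1) a F.sym_bracket_commute[OF y(1) s(1)] by simp
        then have "sym_bracket G (\<phi> y) (\<phi> s) = \<zero>\<^bsub>G\<^esub>"
          using kill leibniz_hom_sym_bracket[OF F \<phi> y(1) s(1)] by simp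
        moreover have "g = k \<oplus>\<^bsub>G\<^esub> \<phi> y"
          using g \<phi>c[OF y(1)] by (simp add: k_def a_minus_def G.M.a_assoc G.M.l_neg)
        ultimately show ?thesis
          using G.sym_bracket_add_left[OF k \<phi>c[OF y(1)] \<phi>c[OF s(1)]] by simp
      qed
      then have "\<phi> s \<in> lie_center G" using \<phi>c[OF s(1)] by (simp add: lie_center_def)
      then show "a \<in> f ` lie_center G" using f\<phi>[OF s(1)] s(2) by (metis imageI)
    qed
  qed
qed


section \<open>Linear maps out of a tensor product\<close>

lemma carrier_free_module_iff:
  "\<phi> \<in> carrier (free_module K B) \<longleftrightarrow>
    (\<forall>b. \<phi> b \<in> carrier K) \<and> (\<forall>b. b \<notin> B \<longrightarrow> \<phi> b = \<zero>\<^bsub>K\<^esub>) \<and> finite {b. \<phi> b \<noteq> \<zero>\<^bsub>K\<^esub>}"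
  by (auto simp: free_module_def)

lemma free_module_ops:
  "\<phi> \<oplus>\<^bsub>free_module K B\<^esub> \<psi> = (\<lambda>b. \<phi> b \<oplus>\<^bsub>K\<^esub> \<psi> b)"
  "\<zero>\<^bsub>free_module K B\<^esub> = (\<lambda>_. \<zero>\<^bsub>K\<^esub>)"
  "c \<odot>\<^bsub>free_module K B\<^esub> \<phi> = (\<lambda>b. c \<otimes>\<^bsub>K\<^esub> \<phi> b)"
  by (simp_all add: free_module_def)

context cring begin

lemma free_gen_in_free_module: "b \<in> B \<Longrightarrow> free_gen R b \<in> carrier (free_module R B)"
  by (auto simp: carrier_free_module_iff free_gen_def)

lemma module_free_module:
  fixes B :: "'i set"
  shows "module R (free_module R B)"
proof (rule moduleI[OF is_cring abelian_groupI], unfold free_module_ops carrier_free_module_iff)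
  fix \<phi> \<psi> \<chi> :: "'i \<Rightarrow> 'a" and c d :: 'a
  assume \<phi>: "(\<forall>b. \<phi> b \<in> carrier R) \<and> (\<forall>b. b \<notin> B \<longrightarrow> \<phi> b = \<zero>) \<and> finite {b. \<phi> b \<noteq> \<zero>}"
  show "\<exists>\<psi>\<in>carrier (free_module R B). (\<lambda>b. \<psi> b \<oplus> \<phi> b) = (\<lambda>_. \<zero>)"
  proof (intro bexI[of _ "\<lambda>b. \<ominus> \<phi> b"])
    have "{b. \<ominus> \<phi> b \<noteq> \<zero>} \<subseteq> {b. \<phi> b \<noteq> \<zero>}" by auto
    then show "(\<lambda>b. \<ominus> \<phi> b) \<in> carrier (free_module R B)"
      using \<phi> by (auto simp: carrier_free_module_iff intro: finite_subset)
  qed (use \<phi> in \<open>simp add: l_neg\<close>)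
  show "(\<lambda>b. \<one> \<otimes> \<phi> b) = \<phi>" "(\<lambda>b. \<zero> \<oplus> \<phi> b) = \<phi>" using \<phi> by simp_all
  assume c: "c \<in> carrier R"
  have "{b. c \<otimes> \<phi> b \<noteq> \<zero>} \<subseteq> {b. \<phi> b \<noteq> \<zero>}" using c by auto
  then show "(\<forall>b. c \<otimes> \<phi> b \<in> carrier R) \<and> (\<forall>b. b \<notin> B \<longrightarrow> c \<otimes> \<phi> b = \<zero>) \<and> finite {b. c \<otimes> \<phi> b \<noteq> \<zero>}"
    using \<phi> c by (auto intro: finite_subset)
  show "(\<lambda>b. (c \<oplus> d) \<otimes> \<phi> b) = (\<lambda>b. c \<otimes> \<phi> b \<oplus> d \<otimes> \<phi> b)" "(\<lambda>b. c \<otimes> d \<otimes> \<phi> b) = (\<lambda>b. c \<otimes> (d \<otimes> \<phi> b))"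
    if "d \<in> carrier R" using \<phi> c that by (simp_all add: l_distr m_assoc)
  assume \<psi>: "(\<forall>b. \<psi> b \<in> carrier R) \<and> (\<forall>b. b \<notin> B \<longrightarrow> \<psi> b = \<zero>) \<and> finite {b. \<psi> b \<noteq> \<zero>}"
  show "(\<lambda>b. c \<otimes> (\<phi> b \<oplus> \<psi> b)) = (\<lambda>b. c \<otimes> \<phi> b \<oplus> c \<otimes> \<psi> b)" using \<phi> \<psi> c by (simp add: r_distr)
next
  fix \<phi> \<psi> \<chi> :: "'i \<Rightarrow> 'a"
  assume \<phi>: "(\<forall>b. \<phi> b \<in> carrier R) \<and> (\<forall>b. b \<notin> B \<longrightarrow> \<phi> b = \<zero>) \<and> finite {b. \<phi> b \<noteq> \<zero>}"
    and \<psi>: "(\<forall>b. \<psi> b \<in> carrier R) \<and> (\<forall>b. b \<notin> B \<longrightarrow> \<psi> b = \<zero>) \<and> finite {b. \<psi> b \<noteq> \<zero>}"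
  have "{b. \<phi> b \<oplus> \<psi> b \<noteq> \<zero>} \<subseteq> {b. \<phi> b \<noteq> \<zero>} \<union> {b. \<psi> b \<noteq> \<zero>}" by auto
  then show "(\<forall>b. \<phi> b \<oplus> \<psi> b \<in> carrier R) \<and> (\<forall>b. b \<notin> B \<longrightarrow> \<phi> b \<oplus> \<psi> b = \<zero>) \<and> finite {b. \<phi> b \<oplus> \<psi> b \<noteq> \<zero>}"
    using \<phi> \<psi> by (auto intro: finite_subset[where B = "{b. \<phi> b \<noteq> \<zero>} \<union> {b. \<psi> b \<noteq> \<zero>}"])
  show "(\<lambda>b. \<phi> b \<oplus> \<psi> b) = (\<lambda>b. \<psi> b \<oplus> \<phi> b)" using \<phi> \<psi> by (simp add: a_comm)
  assume \<chi>: "(\<forall>b. \<chi> b \<in> carrier R) \<and> (\<forall>b. b \<notin> B \<longrightarrow> \<chi> b = \<zero>) \<and> finite {b. \<chi> b \<noteq> \<zero>}"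
  show "(\<lambda>b. \<phi> b \<oplus> \<psi> b \<oplus> \<chi> b) = (\<lambda>b. \<phi> b \<oplus> (\<psi> b \<oplus> \<chi> b))" using \<phi> \<psi> \<chi> by (simp add: a_assoc)
qed simp

text \<open>The unit functions span: remove the points of the finite support one at a time.\<close>

lemma free_module_subset_submodule:
  assumes H: "submodule H R (free_module R B)" and gen: "\<And>b. b \<in> B \<Longrightarrow> free_gen R b \<in> H"
  shows "carrier (free_module R B) \<subseteq> H"
proof
  interpret T: module R "free_module R B" by (rule module_free_module)
  have ind: "\<phi> \<in> H" if "finite S" "\<phi> \<in> carrier (free_module R B)" "{b. \<phi> b \<noteq> \<zero>} \<subseteq> S" for S \<phi>
    using that
  proof (induction S arbitrary: \<phi> rule: finite_induct)
    case empty
    then have "\<phi> = \<zero>\<^bsub>free_module R B\<^esub>" by (auto simp: free_module_ops)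
    then show ?case using subgroup.one_closed[OF submodule.axioms(1)[OF H]] by simp
  next
    case (insert c S)
    have \<phi>: "\<And>b. \<phi> b \<in> carrier R" "\<And>b. b \<notin> B \<Longrightarrow> \<phi> b = \<zero>" "finite {b. \<phi> b \<noteq> \<zero>}"
      using insert.prems(1) by (auto simp: carrier_free_module_iff)
    show ?case
    proof (cases "c \<in> B")
      case True
      let ?\<psi> = "\<phi>(c := \<zero>)"
      have "{b. ?\<psi> b \<noteq> \<zero>} \<subseteq> {b. \<phi> b \<noteq> \<zero>}" by auto
      then have "?\<psi> \<in> carrier (free_module R B)"
        using \<phi> by (auto simp: carrier_free_module_iff intro: finite_subset)
      moreover have "{b. ?\<psi> b \<noteq> \<zero>} \<subseteq> S" using insert.prems(2) by auto
      ultimately have "?\<psi> \<in> H" using insert.IH by blast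
      moreover have "\<phi> = ?\<psi> \<oplus>\<^bsub>free_module R B\<^esub> \<phi> c \<odot>\<^bsub>free_module R B\<^esub> free_gen R c"
        using \<phi>(1) by (auto simp: free_module_ops free_gen_def)
      ultimately show ?thesis
        using T.submoduleE(5)[OF H _ T.submoduleE(4)[OF H \<phi>(1)[of c] gen[OF True]]] by metis
    next
      case False
      then have "{b. \<phi> b \<noteq> \<zero>} \<subseteq> S" using insert.prems(2) \<phi>(2) by auto
      then show ?thesis using insert.IH insert.prems(1) by blast
    qed
  qed
  show "\<phi> \<in> H" if "\<phi> \<in> carrier (free_module R B)" for \<phi>
    using ind[of "{b. \<phi> b \<noteq> \<zero>}" \<phi>] that by (simp add: carrier_free_module_iff)
qed

end

lemma tensor_rel_submodule:
  assumes M: "module K M" and N: "module K N"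
  shows "submodule (tensor_rel_span K M N) K (free_module K (carrier M \<times> carrier N))"
proof -
  interpret M: module K M by fact
  interpret N: module K N by fact
  interpret T: module K "free_module K (carrier M \<times> carrier N)" by (rule M.R.module_free_module)
  show ?thesis
    unfolding tensor_rel_span_def tensor_relators_def Let_def
    by (rule T.lin_span_submodule) (auto intro!: T.M.minus_closed T.M.a_closed T.smult_closed M.R.free_gen_in_free_module)
qed

text \<open>Pulled back to the free module on pairs, the kernel of \<open>C\<close> is a submodule that contains all unit
  functions, hence everything.\<close>

lemma is_zero_map_tensor:
  assumes M: "module K M" and N: "module K N" and P: "module K P"
    and C: "C \<in> linear_hom K (tensor K M N) P"
    and pure: "\<And>m n. m \<in> carrier M \<Longrightarrow> n \<in> carrier N \<Longrightarrow> C (pure_tensor K M N m n) = \<zero>\<^bsub>P\<^esub>"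
  shows "is_zero_map (tensor K M N) P C"
proof -
  interpret M: module K M by fact
  interpret N: module K N by fact
  interpret P: module K P by fact
  define T where "T = free_module K (carrier M \<times> carrier N)"
  define W where "W = tensor_rel_span K M N"
  interpret T: module K T unfolding T_def by (rule M.R.module_free_module)
  have W: "submodule W K T" unfolding W_def T_def by (rule tensor_rel_submodule[OF M N])
  have TW: "tensor K M N = quot_module T W" unfolding tensor_def T_def W_def ..
  interpret TW: module K "quot_module T W" by (rule T.module_quot_module[OF W])
  have C_add: "C (W +>\<^bsub>T\<^esub> (\<phi> \<oplus>\<^bsub>T\<^esub> \<psi>)) = C (W +>\<^bsub>T\<^esub> \<phi>) \<oplus>\<^bsub>P\<^esub> C (W +>\<^bsub>T\<^esub> \<psi>)"
    if "\<phi> \<in> carrier T" "\<psi> \<in> carrier T" for \<phi> \<psi>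
    using C that unfolding TW linear_hom_def
    by (simp add: T.carrier_quot_module[OF W] T.add_quot_module[OF W, symmetric])
  have C_smult: "C (W +>\<^bsub>T\<^esub> (c \<odot>\<^bsub>T\<^esub> \<phi>)) = c \<odot>\<^bsub>P\<^esub> C (W +>\<^bsub>T\<^esub> \<phi>)"
    if "c \<in> carrier K" "\<phi> \<in> carrier T" for c \<phi>
    using C that unfolding TW linear_hom_def
    by (simp add: T.carrier_quot_module[OF W] T.smult_quot_module[OF W, symmetric])
  have C_closed: "C (W +>\<^bsub>T\<^esub> \<phi>) \<in> carrier P" if "\<phi> \<in> carrier T" for \<phi>
    using C that unfolding TW linear_hom_def by (auto simp: T.carrier_quot_module[OF W])
  let ?Z = "{\<phi> \<in> carrier T. C (W +>\<^bsub>T\<^esub> \<phi>) = \<zero>\<^bsub>P\<^esub>}"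
  have "submodule ?Z K T"
  proof (rule T.submoduleI)
    have "C (W +>\<^bsub>T\<^esub> (\<zero>\<^bsub>K\<^esub> \<odot>\<^bsub>T\<^esub> \<zero>\<^bsub>T\<^esub>)) = \<zero>\<^bsub>P\<^esub>"
      using C_smult[of "\<zero>\<^bsub>K\<^esub>" "\<zero>\<^bsub>T\<^esub>"] C_closed[of "\<zero>\<^bsub>T\<^esub>"] by simp
    then show "\<zero>\<^bsub>T\<^esub> \<in> ?Z" by simp
    show "\<ominus>\<^bsub>T\<^esub> \<phi> \<in> ?Z" if "\<phi> \<in> ?Z" for \<phi>
    proof -
      have "\<ominus>\<^bsub>T\<^esub> \<phi> = \<ominus>\<^bsub>K\<^esub> \<one>\<^bsub>K\<^esub> \<odot>\<^bsub>T\<^esub> \<phi>" using that by (simp add: T.smult_l_minus)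
      then show ?thesis using that C_smult[of "\<ominus>\<^bsub>K\<^esub> \<one>\<^bsub>K\<^esub>" \<phi>] by simp
    qed
  qed (auto simp: C_add C_smult)
  moreover have "free_gen K b \<in> ?Z" if "b \<in> carrier M \<times> carrier N" for b
    using that pure M.R.free_gen_in_free_module[OF that] by (auto simp: pure_tensor_def T_def W_def)
  ultimately have "carrier T \<subseteq> ?Z"
    using M.R.free_module_subset_submodule[of ?Z "carrier M \<times> carrier N"] unfolding T_def by blast
  then show ?thesis unfolding is_zero_map_def TW T.carrier_quot_module[OF W] by blast
qed


section \<open>The first map and the precise Lie-center\<close>

text \<open>The denominator \<open>[R, F]\<^sub>L\<^sub>i\<^sub>e\<close> lies in both parts of the numerator \<open>R \<inter> [F, F]\<^sub>L\<^sub>i\<^sub>e\<close>: in the first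
  because \<open>R\<close> is an ideal, in the second by monotonicity.\<close>

lemma (in leibniz_algebra) module_HL2_Lie:
  assumes R: "leibniz_ideal K Q R"
  shows "module K (HL2_Lie K Q R)"
proof -
  let ?H = "R \<inter> lie_commutator K Q (carrier Q) (carrier Q)"
  let ?N = "lie_commutator K Q R (carrier Q)"
  have car: "leibniz_ideal K Q (carrier Q)"
    using carrier_is_submodule bracket_closed by (simp add: leibniz_ideal_def)
  note sub = ideal_submodule[OF R] ideal_submodule[OF leibniz_ideal_lie_commutator[OF R]]
    ideal_submodule[OF leibniz_ideal_lie_commutator[OF car]]
  have H: "submodule ?H K Q" by (rule submodule_Int[OF sub(1,3)])
  have "?N \<subseteq> ?H"
    using lie_commutator_subset_ideal[OF R] lie_commutator_mono[OF submoduleE(1)[OF sub(1)]] by blast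
  then have "submodule ?N K (Q\<lparr>carrier := ?H\<rparr>)" by (rule submodule_of_submodule[OF sub(2) H])
  then show ?thesis
    unfolding HL2_Lie_def
    by (rule module.module_quot_module[OF submodule.submodule_is_module[OF H module_axioms]])
qed

theorem theorem4p9:
  fixes K :: "'k ring" (structure)
    and Q :: "('k, 'q) leibniz" and A :: "'q set"
    and F :: "('k, 'f) leibniz" and \<rho> :: "'f \<Rightarrow> 'q"
  assumes "field K" and "\<one> \<oplus> \<one> \<in> Units K"
    and "leibniz_algebra K Q"
    and "leibniz_ideal K Q A"
    and "A \<subseteq> lie_center Q"
    and "free_presentation K F Q \<rho>"
  shows
    "(\<forall>C. first_map K F Q \<rho> A C \<longrightarrow>
       (A \<subseteq> precise_lie_center K Q \<longleftrightarrow>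
        is_zero_map (tensor_ideal_liezation K Q A) (HL2_Lie K F (a_kernel F Q \<rho>)) C)) \<and>
     (A \<subseteq> precise_lie_center K Q \<longleftrightarrow>
       (\<exists>C. first_map K F Q \<rho> A C \<and>
        is_zero_map (tensor_ideal_liezation K Q A) (HL2_Lie K F (a_kernel F Q \<rho>)) C))"
proof -
  have F: "leibniz_algebra K F" and \<rho>: "\<rho> \<in> leibniz_hom K F Q" and surj: "\<rho> ` carrier F = carrier Q"
    using assms(6) unfolding free_presentation_def free_leibniz_on_def by blast+
  interpret F: leibniz_algebra K F by (rule F)
  interpret Q: leibniz_algebra K Q by (rule assms(3))
  define R where "R = a_kernel F Q \<rho>"
  define N where "N = lie_commutator K F R (carrier F)"
  define QA where "QA = Q\<lparr>carrier := A\<rparr>"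
  define P where "P = HL2_Lie K F R"
  note A = assms(4)
  have R: "leibniz_ideal K F R" unfolding R_def by (rule leibniz_ideal_kernel[OF F assms(3) \<rho>])
  have N: "leibniz_ideal K F N" unfolding N_def by (rule F.leibniz_ideal_lie_commutator[OF R])
  note coset_N = F.coset_eq_submodule_iff[OF F.ideal_submodule[OF N]]
  have Ac: "a \<in> carrier Q" if "a \<in> A" for a
    using that Q.submoduleE(1)[OF Q.ideal_submodule[OF A]] by blast
  have QA: "module K QA"
    unfolding QA_def by (rule submodule.submodule_is_module[OF Q.ideal_submodule[OF A] Q.module_axioms])
  have LQ: "module K (liezation K Q)"
    unfolding liezation_def by (rule Q.module_quot_leibniz[OF Q.leibniz_ideal_ann])
  have P: "module K P" unfolding P_def by (rule F.module_HL2_Lie[OF R])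
  interpret P: module K P by (rule P)
  have P0: "\<zero>\<^bsub>P\<^esub> = N" unfolding P_def HL2_Lie_def N_def quot_module_def by simp
  have S: "s \<in> a_kernel F (quot_leibniz Q A) ((\<lambda>q. A +>\<^bsub>Q\<^esub> q) \<circ> \<rho>) \<longleftrightarrow> s \<in> carrier F \<and> \<rho> s \<in> A" for s
    using leibniz_hom_closed[OF \<rho>, of s] Q.coset_eq_submodule_iff[OF Q.ideal_submodule[OF A], of "\<rho> s"]
    by (auto simp: a_kernel_iff Q.zero_quot_leibniz[OF A])
  have first: "first_map K F Q \<rho> A C \<longleftrightarrow> C \<in> linear_hom K (tensor K QA (liezation K Q)) P \<and>
      (\<forall>s\<in>carrier F. \<forall>y\<in>carrier F. \<rho> s \<in> A \<longrightarrow>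
        C (pure_tensor K QA (liezation K Q) (\<rho> s) (leibniz_ann K Q +>\<^bsub>Q\<^esub> \<rho> y)) = N +>\<^bsub>F\<^esub> sym_bracket F s y)" for C
    using leibniz_hom_closed[OF \<rho>]
    unfolding first_map_def Let_def tensor_ideal_liezation_def R_def[symmetric] N_def[symmetric]
      P_def[symmetric] QA_def[symmetric] by (auto simp: S)
  \<comment> \<open>the statement about \<open>F\<close> through which both sides are compared\<close>
  define crit where "crit \<longleftrightarrow> (\<forall>s\<in>carrier F. \<forall>y\<in>carrier F. \<rho> s \<in> A \<longrightarrow> sym_bracket F s y \<in> N)"
  have prec: "A \<subseteq> precise_lie_center K Q \<longleftrightarrow> crit"
    using subset_precise_lie_center_iff[OF assms(1,6), of A] Ac unfolding crit_def N_def R_def by blast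
  have zero: "is_zero_map (tensor K QA (liezation K Q)) P C \<longleftrightarrow> crit" if C: "first_map K F Q \<rho> A C" for C
  proof
    assume z: "is_zero_map (tensor K QA (liezation K Q)) P C"
    show crit unfolding crit_def
    proof (intro ballI impI)
      fix s y assume s: "s \<in> carrier F" and y: "y \<in> carrier F" and sA: "\<rho> s \<in> A"
      let ?n = "leibniz_ann K Q +>\<^bsub>Q\<^esub> \<rho> y"
      have "?n \<in> carrier (liezation K Q)"
        using leibniz_hom_closed[OF \<rho> y] Q.carrier_quot_leibniz[OF Q.leibniz_ideal_ann] by (simp add: liezation_def)
      then have "pure_tensor K QA (liezation K Q) (\<rho> s) ?n \<in> carrier (tensor K QA (liezation K Q))"
        unfolding tensor_def pure_tensor_def
          module.carrier_quot_module[OF F.R.module_free_module tensor_rel_submodule[OF QA LQ]]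
        using sA by (intro imageI F.R.free_gen_in_free_module) (simp add: QA_def)
      then have "C (pure_tensor K QA (liezation K Q) (\<rho> s) ?n) = N"
        using z unfolding is_zero_map_def P0 by blast
      moreover have "C (pure_tensor K QA (liezation K Q) (\<rho> s) ?n) = N +>\<^bsub>F\<^esub> sym_bracket F s y"
        using C s y sA unfolding first by blast
      ultimately have "N +>\<^bsub>F\<^esub> sym_bracket F s y = N" by simp
      then show "sym_bracket F s y \<in> N" using coset_N F.sym_bracket_closed[OF s y] by simp
    qed
  next
    assume c: crit
    show "is_zero_map (tensor K QA (liezation K Q)) P C"
    proof (rule is_zero_map_tensor[OF QA LQ P])
      show "C \<in> linear_hom K (tensor K QA (liezation K Q)) P" using C unfolding first by blast
      fix a n assume "a \<in> carrier QA" and n: "n \<in> carrier (liezation K Q)"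
      then have a: "a \<in> A" by (simp add: QA_def)
      obtain x where x: "x \<in> carrier Q" "n = leibniz_ann K Q +>\<^bsub>Q\<^esub> x"
        using n Q.carrier_quot_leibniz[OF Q.leibniz_ideal_ann] by (auto simp: liezation_def)
      obtain s y where s: "s \<in> carrier F" "\<rho> s = a" and y: "y \<in> carrier F" "\<rho> y = x"
        using Ac[OF a] x(1) surj by (metis imageE)
      have "sym_bracket F s y \<in> N" using c s y(1) a unfolding crit_def by blast
      then have "N +>\<^bsub>F\<^esub> sym_bracket F s y = N" using coset_N F.sym_bracket_closed[OF s(1) y(1)] by simp
      then show "C (pure_tensor K QA (liezation K Q) a n) = \<zero>\<^bsub>P\<^esub>"
        using C s y a x(2) unfolding first P0 by auto
    qed
  qed
  \<comment> \<open>\<open>N\<close> is the zero of the target, so this is the zero map; under \<open>crit\<close> it satisfies the formula,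
    which settles the existence of \<open>C\<close> on that side\<close>
  have ex: "first_map K F Q \<rho> A (\<lambda>_. N)" if crit
    unfolding first
  proof (intro conjI ballI impI)
    show "(\<lambda>_. N) \<in> linear_hom K (tensor K QA (liezation K Q)) P"
      using P.M.zero_closed P.M.l_zero[OF P.M.zero_closed] P.smult_r_null unfolding linear_hom_def P0 by simp
    fix s y assume "s \<in> carrier F" "y \<in> carrier F" "\<rho> s \<in> A"
    then show "N = N +>\<^bsub>F\<^esub> sym_bracket F s y"
      using that coset_N[of "sym_bracket F s y"] F.sym_bracket_closed unfolding crit_def by blast
  qed
  show ?thesis
    unfolding tensor_ideal_liezation_def QA_def[symmetric] R_def[symmetric] P_def[symmetric] prec
    using zero ex by blast
qed

end
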